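(* Let $n\ge 3$, $2\le \Delta\le n-1$, and $\alpha_1\le \alpha<0$, where $\alpha_1\approx -1.7036$ is the unique root of $\frac{3^\alpha-4^\alpha}{4^\alpha-5^\alpha}=2$. For every tree $G$ with $n$ vertices and maximum degree $\Delta$, \[\chi_\alpha(G)\le \begin{cases} \big((\Delta+2)^\alpha-(\Delta+1)^\alpha+3^\alpha\big)(n-\Delta-1)+\Delta(\Delta+1)^\alpha & \text{if } \frac{n}{2}\le \Delta\le n-1,\\ \big((\Delta+2)^\alpha+3^\alpha-4^\alpha\big)\Delta+(n-\Delta-1)4^\alpha & \text{if } 2\le \Delta\le \frac{n-1}{2}.\end{cases}\] For $\frac{n}{2}\le\Delta\le n-1$ equality holds if and only if $G=T_{n,\Delta}$; for $2\le\Delta\le\frac{n-1}{2}$ equality holds if and only if $G$ is a tree obtained from a single vertex by attaching $\Delta$ paths, each having at least two vertices, to that vertex.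
   Context: All graphs are finite and simple; $d(v)$ denotes the degree of $v$. The general sum-connectivity index is $\chi_\alpha(G)=\sum_{uv\in E(G)}(d(u)+d(v))^\alpha$. Attaching a path $P_r$ (path on $r$ vertices) to a vertex $v$ means adding a disjoint copy of $P_r$ and an edge between $v$ and a terminal vertex of the path. For $\frac n2\le\Delta\le n-1$, $T_{n,\Delta}$ is the tree obtained from a single vertex $v$ by attaching $2\Delta+1-n$ pendant vertices and $n-\Delta-1$ copies of $P_2$ (paths of length two from $v$) to $v$; it has $n$ vertices and maximum degree $\Delta$. *)

theory Defs
  imports Complex_Main
begin

definition simple_graph :: "'a set \<Rightarrow> 'a set set \<Rightarrow> bool" where
  "simple_graph V E \<longleftrightarrow> finite V \<and>
     (\<forall>e\<in>E. \<exists>u v. u \<in> V \<and> v \<in> V \<and> u \<noteq> v \<and> e = {u, v})"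

definition degree :: "'a set set \<Rightarrow> 'a \<Rightarrow> nat" where
  "degree E v = card {e \<in> E. v \<in> e}"

definition max_degree :: "'a set \<Rightarrow> 'a set set \<Rightarrow> nat" where
  "max_degree V E = Max (degree E ` V)"

definition connected_graph :: "'a set \<Rightarrow> 'a set set \<Rightarrow> bool" where
  "connected_graph V E \<longleftrightarrow> V \<noteq> {} \<and>
     (\<forall>u\<in>V. \<forall>v\<in>V. (\<lambda>x y. {x, y} \<in> E)\<^sup>*\<^sup>* u v)"

definition has_cycle :: "'a set \<Rightarrow> 'a set set \<Rightarrow> bool" where
  "has_cycle V E \<longleftrightarrow> (\<exists>cs. 3 \<le> length cs \<and> distinct cs \<and> set cs \<subseteq> V \<and>
     (\<forall>i<length cs. {cs ! i, cs ! ((i + 1) mod length cs)} \<in> E))"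

definition is_tree :: "'a set \<Rightarrow> 'a set set \<Rightarrow> bool" where
  "is_tree V E \<longleftrightarrow> simple_graph V E \<and> connected_graph V E \<and> \<not> has_cycle V E"

definition chi :: "real \<Rightarrow> 'a set set \<Rightarrow> real" where
  "chi \<alpha> E = (\<Sum>e\<in>E. (\<Sum>v\<in>e. real (degree E v)) powr \<alpha>)"

definition graph_iso :: "'a set \<Rightarrow> 'a set set \<Rightarrow> 'b set \<Rightarrow> 'b set set \<Rightarrow> bool" where
  "graph_iso V E V' E' \<longleftrightarrow> (\<exists>f. bij_betw f V V' \<and>
     (\<forall>u\<in>V. \<forall>v\<in>V. {u, v} \<in> E \<longleftrightarrow> {f u, f v} \<in> E'))"

text \<open>The tree obtained from a single vertex (0,0) by attaching paths with
  ls!0, ls!1, ... vertices; leg j has vertices (j+1,1), ..., (j+1, ls!j),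
  with (j+1,1) joined to the centre.\<close>
definition spider_V :: "nat list \<Rightarrow> (nat \<times> nat) set" where
  "spider_V ls = {(0, 0)} \<union> {(Suc j, i) | j i. j < length ls \<and> 1 \<le> i \<and> i \<le> ls ! j}"

definition spider_E :: "nat list \<Rightarrow> (nat \<times> nat) set set" where
  "spider_E ls =
     {{(0, 0), (Suc j, 1)} | j. j < length ls \<and> 1 \<le> ls ! j} \<union>
     {{(Suc j, i), (Suc j, Suc i)} | j i. j < length ls \<and> 1 \<le> i \<and> Suc i \<le> ls ! j}"

definition T_legs :: "nat \<Rightarrow> nat \<Rightarrow> nat list" where
  "T_legs n \<Delta> = replicate (2 * \<Delta> + 1 - n) 1 @ replicate (n - \<Delta> - 1) 2"

definition alpha1 :: real where
  "alpha1 = (THE a. a < 0 \<and> (3 powr a - 4 powr a) / (4 powr a - 5 powr a) = 2)"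

end

theory Submission
  imports Defs "HOL-Analysis.Convex"
begin

text \<open>Write \<open>f x = x powr \<alpha>\<close>, root the tree at a vertex of degree \<open>\<Delta>\<close> and let \<open>p\<close> be the number of children of
  the root that are not leaves. Start from weight \<open>f 3\<close> for edges above leaves and \<open>f 4\<close> for the other edges.
  A vertex of degree \<open>d\<close> other than the root loses at least \<open>f 4 - f (d + 2)\<close> on each of its \<open>d - 1\<close> child edges,
  and it creates \<open>d - 2\<close> leaves beyond the \<open>\<Delta>\<close> forced by the root, each gaining \<open>f 3 - f 4\<close>.
  The condition \<open>alpha1 \<le> \<alpha>\<close> gives \<open>f k - f (k + 1) \<le> 2 * (f (k + 1) - f (k + 2))\<close> for \<open>k \<ge> 3\<close>, and by
  geometric summation \<open>(d - 2) * (f 3 - f 4) \<le> (d - 1) * (f 4 - f (d + 2))\<close>, so branching away from the root does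
  not pay; it is strictly worse, because the edge above a branching vertex loses more than it was charged.
  What remains is a spider, whose weight depends only on \<open>p\<close> and increases with \<open>p\<close> (it is constant for \<open>\<Delta> = 2\<close>), while
  \<open>p \<le> min \<Delta> (n - 1 - \<Delta>)\<close>; the two cases of the theorem are the two values of this minimum.\<close>

section \<open>Inequalities for negative powers\<close>

text \<open>The equation defining \<open>alpha1\<close>, cleared of its denominator and divided by
  \<open>4 powr a\<close>. A sum of two exponentials in \<open>a\<close> minus a constant is convex,
  which the quotient does not show.\<close>

definition root_fun :: "real \<Rightarrow> real" where
  "root_fun a = (3/4) powr a + 2 * (5/4) powr a - 3"

lemma root_fun_deriv:
  "(root_fun has_real_derivative (ln (3/4) * (3/4) powr a + 2 * ln (5/4) * (5/4) powr a)) (at a)"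
  unfolding root_fun_def by (auto intro!: derivative_eq_intros)

text \<open>Strict convexity of \<open>root_fun\<close> in the form used with the mean value
  theorem: a negative logarithm times a decreasing power plus a positive logarithm times an
  increasing one.\<close>

lemma root_fun_deriv_strict_mono:
  assumes "a < b"
  shows "ln (3/4) * (3/4) powr a + 2 * ln (5/4) * (5/4) powr a
    < ln (3/4) * (3/4) powr b + 2 * ln (5/4) * (5/4::real) powr b"
proof -
  have "(3/4) powr b < (3/4::real) powr a" "(5/4) powr a < (5/4::real) powr b"
    using assms by (simp_all add: powr_less_mono' powr_less_mono)
  moreover have "ln (3/4) < (0::real)" "0 < ln (5/4::real)" by auto
  ultimately show ?thesis
    by (intro add_strict_mono mult_strict_left_mono_neg mult_strict_left_mono) simp_all
qed

lemma root_fun_zero [simp]: "root_fun 0 = 0"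
  by (simp add: root_fun_def)

text \<open>A strictly convex function that is at most 0 at \<open>a\<close> and vanishes at 0 is
  negative in between. Otherwise there is a nonnegative slope at some \<open>y < b\<close> and a
  nonpositive slope at some \<open>z > b\<close>, although the slope increases strictly.\<close>

lemma root_fun_neg_between:
  assumes "root_fun a \<le> 0" "a < b" "b < 0"
  shows "root_fun b < 0"
proof (rule ccontr)
  assume "\<not> root_fun b < 0"
  then have b: "0 \<le> root_fun b" by simp
  obtain y where y: "a < y" "y < b"
    "root_fun b - root_fun a = (b - a) * (ln (3/4) * (3/4) powr y + 2 * ln (5/4) * (5/4) powr y)"
    using MVT2[OF \<open>a < b\<close> root_fun_deriv] by blast
  obtain z where z: "b < z" "z < 0"
    "root_fun 0 - root_fun b = (0 - b) * (ln (3/4) * (3/4) powr z + 2 * ln (5/4) * (5/4) powr z)"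
    using MVT2[OF \<open>b < 0\<close> root_fun_deriv] by blast
  have "0 \<le> ln (3/4) * (3/4) powr y + 2 * ln (5/4) * (5/4) powr y"
    using y b assms zero_le_mult_iff[of "b - a" "ln (3/4) * (3/4) powr y + 2 * ln (5/4) * (5/4) powr y"]
    by linarith
  moreover have "ln (3/4) * (3/4) powr z + 2 * ln (5/4) * (5/4) powr z \<le> 0"
    using z b assms mult_le_0_iff[of "0 - b" "ln (3/4) * (3/4) powr z + 2 * ln (5/4) * (5/4) powr z"]
    by (simp only: root_fun_zero) linarith
  ultimately show False
    using root_fun_deriv_strict_mono[of y z] y z by linarith
qed

lemma root_fun_iff:
  assumes "a < 0"
  shows "(3 powr a - 4 powr a) / (4 powr a - 5 powr a) = 2 \<longleftrightarrow> root_fun a = 0"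
proof -
  have pos: "4 powr a - 5 powr a > 0" "4 powr a > 0"
    using powr_less_mono2_neg[of a 4 5] assms by auto
  have e: "root_fun a * 4 powr a = 3 powr a - 4 powr a - 2 * (4 powr a - 5 powr a)"
    by (simp add: root_fun_def powr_divide algebra_simps)
  show ?thesis using pos e by (auto simp: divide_eq_eq)
qed

lemma alpha1_root: "alpha1 < 0" "root_fun alpha1 = 0"
proof -
  have neg2: "root_fun (-2) \<ge> 0"
    by (simp add: root_fun_def powr_minus power2_eq_square)
  have neg1: "root_fun (-1) \<le> 0"
    by (simp add: root_fun_def powr_minus)
  have "continuous_on {-2..-1} root_fun"
    by (meson root_fun_deriv DERIV_isCont continuous_at_imp_continuous_on)
  then obtain a where a: "-2 \<le> a" "a \<le> -1" "root_fun a = 0"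
    using IVT2'[of root_fun "-1" 0 "-2"] neg1 neg2 by auto
  \<comment> \<open>Of two distinct negative roots the larger lies between a root and 0, where
    \<open>root_fun\<close> is negative.\<close>
  have uniq: "b = c" if "b < 0" "root_fun b = 0" "c < 0" "root_fun c = 0" for b c
    using root_fun_neg_between[of b c] root_fun_neg_between[of c b] that
    by (cases b c rule: linorder_cases) auto
  have "\<exists>!a. a < 0 \<and> (3 powr a - 4 powr a) / (4 powr a - 5 powr a) = (2::real)"
    using a uniq root_fun_iff by (intro ex1I[of _ a]) auto
  then have "alpha1 < 0 \<and> (3 powr alpha1 - 4 powr alpha1) / (4 powr alpha1 - 5 powr alpha1) = 2"
    unfolding alpha1_def by (rule theI')
  then show "alpha1 < 0" "root_fun alpha1 = 0" using root_fun_iff by auto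
qed

text \<open>This sign is the form in which the hypothesis on \<open>alpha1\<close> enters the
  estimates.\<close>

lemma root_fun_le_0: "alpha1 \<le> a \<Longrightarrow> a < 0 \<Longrightarrow> root_fun a \<le> 0"
  using root_fun_neg_between[of alpha1 a] alpha1_root by (cases "a = alpha1") auto

section \<open>Differences of consecutive powers\<close>

lemma powr_neg_convex:
  assumes "a < (0::real)"
  shows "convex_on {0<..} (\<lambda>x. x powr a)"
proof (rule f''_ge0_imp_convex[where f' = "\<lambda>x. a * x powr (a - 1)"
      and f'' = "\<lambda>x. a * ((a - 1) * x powr (a - 2))"])
  fix x :: real assume x: "x \<in> {0<..}"
  show "((\<lambda>x. x powr a) has_real_derivative a * x powr (a - 1)) (at x)"
    using x by (auto intro!: derivative_eq_intros)
  show "((\<lambda>x. a * x powr (a - 1)) has_real_derivative a * ((a - 1) * x powr (a - 2))) (at x)"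
    using x by (auto intro!: derivative_eq_intros)
  show "0 \<le> a * ((a - 1) * x powr (a - 2))"
    using assms by (simp add: mult_nonpos_nonpos mult_nonpos_nonneg)
qed auto

text \<open>Strict convexity: the drop \<open>t powr a - (t + 1) powr a\<close> has derivative
  \<open>a * (t powr (a - 1) - (t + 1) powr (a - 1))\<close>, a negative times a positive
  number.\<close>

lemma powr_diff_strict_antimono:
  assumes "a < (0::real)" "0 < x" "x < y"
  shows "y powr a - (y + 1) powr a < x powr a - (x + 1) powr a"
proof -
  have "\<exists>D. ((\<lambda>t. t powr a - (t + 1) powr a) has_real_derivative D) (at t) \<and> D < 0"
    if "x \<le> t" for t
  proof -
    have "((\<lambda>t. t powr a - (t + 1) powr a) has_real_derivative
        a * (t powr (a - 1) - (t + 1) powr (a - 1))) (at t)"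
      using that assms by (auto intro!: derivative_eq_intros simp: algebra_simps)
    moreover have "(t + 1) powr (a - 1) < t powr (a - 1)"
      using that assms by (intro powr_less_mono2_neg) auto
    ultimately show ?thesis using assms(1) by (metis diff_gt_0_iff_gt mult_neg_pos)
  qed
  then show ?thesis using DERIV_neg_imp_decreasing[OF \<open>x < y\<close>] by blast
qed

text \<open>With \<open>s = 1 / (k + 1) \<le> 1/4\<close> the claim reads \<open>(1 - s) powr a + 2 * (1 + s) powr a \<le> 3\<close>. The left-hand side
  is convex in \<open>s\<close>, equals 3 at \<open>s = 0\<close>, and is at most 3 at \<open>s = 1/4\<close> by the choice of \<open>alpha1\<close>.\<close>
lemma powr_diff_halving:
  assumes "alpha1 \<le> a" "a < 0" "3 \<le> k"
  shows "k powr a - (k + 1) powr a \<le> 2 * ((k + 1) powr a - (k + 2) powr a)"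
proof -
  \<comment> \<open>\<open>t\<close> is \<open>4 * s\<close>: then \<open>k / (k + 1)\<close> and
    \<open>(k + 2) / (k + 1)\<close> are the points at fraction \<open>t\<close> on the way from 1
    to 3/4 and from 1 to 5/4, and \<open>3 \<le> k\<close> gives \<open>t \<le> 1\<close>.\<close>
  define t where "t = 4 / (k + 1)"
  have t: "0 \<le> t" "t \<le> 1" using assms by (auto simp: t_def)
  have cv: "((1 - t) * 1 + t * y) powr a \<le> (1 - t) * 1 powr a + t * y powr a" if "0 < y" for y
    using convex_onD[OF powr_neg_convex[OF assms(2)] t, of 1 y] that by simp
  have kt: "(k + 1) * t = 4"
    using assms nonzero_mult_div_cancel_left[of "k + 1" 4] by (simp only: t_def times_divide_eq_right)
  have k: "k = (k + 1) * ((1 - t) * 1 + t * (3/4))" "k + 2 = (k + 1) * ((1 - t) * 1 + t * (5/4))"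
    using kt by (simp_all add: algebra_simps)
  have pos: "0 \<le> (1 - t) * 1 + t * (3/4)" "0 \<le> (1 - t) * 1 + t * (5/4)" using t by auto
  have "((1 - t) * 1 + t * (3/4)) powr a + 2 * ((1 - t) * 1 + t * (5/4)) powr a \<le> 3 + t * root_fun a"
    using cv[of "3/4"] cv[of "5/4"] by (simp add: root_fun_def algebra_simps)
  also have "\<dots> \<le> 3"
    using root_fun_le_0 assms t by (simp add: mult_nonneg_nonpos)
  finally have "(k + 1) powr a * (((1 - t) * 1 + t * (3/4)) powr a + 2 * ((1 - t) * 1 + t * (5/4)) powr a)
      \<le> (k + 1) powr a * 3"
    by (intro mult_left_mono) auto
  moreover have "k powr a = (k + 1) powr a * ((1 - t) * 1 + t * (3/4)) powr a"
    using powr_mult[of "k + 1" "(1 - t) * 1 + t * (3/4)" a] pos assms k(1) by simp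
  moreover have "(k + 2) powr a = (k + 1) powr a * ((1 - t) * 1 + t * (5/4)) powr a"
    using powr_mult[of "k + 1" "(1 - t) * 1 + t * (5/4)" a] pos assms k(2) by simp
  ultimately show ?thesis by (simp add: algebra_simps)
qed

text \<open>Here \<open>m + 2\<close> is the degree of a branching vertex. The drop at
  \<open>i + 3\<close> is at least the drop at 3 divided by \<open>2 ^ i\<close>; summing for
  \<open>i\<close> from 1 to \<open>m\<close> gives the factor \<open>1 - 1 / 2 ^ m\<close>, which
  is at least \<open>m / (m + 1)\<close> because \<open>m + 1 \<le> 2 ^ m\<close>.\<close>

lemma branching_loss:
  assumes "alpha1 \<le> a" "a < 0"
  shows "real m * (3 powr a - 4 powr a) \<le> (real m + 1) * (4 powr a - (real m + 4) powr a)"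
proof -
  have d: "(3 powr a - 4 powr a) / 2 ^ i \<le> (real i + 3) powr a - (real i + 4) powr a" for i
  proof (induction i)
    case (Suc i)
    have "(3 powr a - 4 powr a) / 2 ^ Suc i = (3 powr a - 4 powr a) / 2 ^ i / 2"
      by simp
    also have "\<dots> \<le> ((real i + 3) powr a - (real i + 4) powr a) / 2"
      using Suc by (rule divide_right_mono) simp
    also have "\<dots> \<le> (real (Suc i) + 3) powr a - (real (Suc i) + 4) powr a"
      using powr_diff_halving[OF assms, of "real i + 3"] by (simp add: add.commute add.left_commute)
    finally show ?case .
  qed simp
  have s: "(1 - 1 / 2 ^ m) * (3 powr a - 4 powr a) \<le> 4 powr a - (real m + 4) powr a"
  proof (induction m)
    case (Suc m)
    then show ?case
      using d[of "Suc m"] by (simp add: field_simps)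
  qed simp
  have "real (m + 1) \<le> 2 ^ m"
    by (induction m) auto
  then have "real m \<le> (real m + 1) * (1 - 1 / 2 ^ m)"
    by (simp add: field_simps)
  moreover have "0 \<le> 3 powr a - 4 powr a"
    using powr_mono2'[of a 3 4] assms by simp
  ultimately have "real m * (3 powr a - 4 powr a)
      \<le> (real m + 1) * (1 - 1 / 2 ^ m) * (3 powr a - 4 powr a)"
    by (rule mult_right_mono)
  also have "\<dots> \<le> (real m + 1) * (4 powr a - (real m + 4) powr a)"
    using s by (simp add: mult_left_mono mult.assoc)
  finally show ?thesis .
qed

section \<open>Rooted trees\<close>

definition is_path :: "'a set \<Rightarrow> 'a set set \<Rightarrow> 'a list \<Rightarrow> bool" where
  "is_path V E xs \<longleftrightarrow> distinct xs \<and> set xs \<subseteq> V \<and>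
     (\<forall>i. Suc i < length xs \<longrightarrow> {xs ! i, xs ! Suc i} \<in> E)"

lemma is_path_rev: "is_path V E xs \<Longrightarrow> is_path V E (rev xs)"
  unfolding is_path_def
proof (intro conjI allI impI; (elim conjE)?)
  fix i assume p: "\<forall>i. Suc i < length xs \<longrightarrow> {xs ! i, xs ! Suc i} \<in> E" and i: "Suc i < length (rev xs)"
  have "{xs ! (length xs - Suc (Suc i)), xs ! Suc (length xs - Suc (Suc i))} \<in> E"
    using p i by auto
  then show "{rev xs ! i, rev xs ! Suc i} \<in> E"
    using i by (simp add: rev_nth Suc_diff_Suc insert_commute)
qed auto

lemma simple_graphD:
  assumes "simple_graph V E" "{x, y} \<in> E"
  shows "x \<in> V" "y \<in> V" "x \<noteq> y"
proof -
  obtain u v where "u \<in> V" "v \<in> V" "u \<noteq> v" "{x, y} = {u, v}"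
    using assms unfolding simple_graph_def by blast
  then show "x \<in> V" "y \<in> V" "x \<noteq> y" by (auto simp: doubleton_eq_iff)
qed

text \<open>An end of a longest path is a leaf: a neighbour off the path would extend it, and a
  neighbour on the path at index 2 or later would close a cycle.\<close>

lemma maximal_path_end:
  assumes tree: "is_tree V E" and path: "is_path V E xs"
    and maxi: "\<And>ys. is_path V E ys \<Longrightarrow> length ys \<le> length xs"
    and len: "2 \<le> length xs" and edge: "{xs ! 0, y} \<in> E"
  shows "y = xs ! 1"
proof -
  have sg: "simple_graph V E" and nc: "\<not> has_cycle V E" using tree by (auto simp: is_tree_def)
  have "y \<in> set xs"
  proof (rule ccontr)
    assume "y \<notin> set xs"
    then have "is_path V E (y # xs)"
      using path edge simple_graphD[OF sg edge]
      by (auto simp: is_path_def nth_Cons insert_commute split: nat.split)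
    then show False using maxi by fastforce
  qed
  then obtain i where i: "i < length xs" "xs ! i = y" by (auto simp: in_set_conv_nth)
  have "i \<noteq> 0" using simple_graphD(3)[OF sg edge] i by (cases i) auto
  moreover have "\<not> 2 \<le> i"
  proof
    assume i2: "2 \<le> i"
    \<comment> \<open>The cycle is the prefix up to \<open>y\<close>; its index wraps around exactly
      at \<open>j = i\<close>, where the edge from \<open>y\<close> back to \<open>xs ! 0\<close> is
      used.\<close>
    have "\<forall>j<length (take (Suc i) xs). {take (Suc i) xs ! j,
        take (Suc i) xs ! ((j + 1) mod length (take (Suc i) xs))} \<in> E"
    proof (intro allI impI)
      fix j assume "j < length (take (Suc i) xs)"
      then have "j < i \<or> j = i" using i by auto
      then show "{take (Suc i) xs ! j, take (Suc i) xs ! ((j + 1) mod length (take (Suc i) xs))} \<in> E"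
      proof
        assume "j < i"
        then show ?thesis using i path by (simp add: is_path_def)
      next
        assume "j = i"
        then show ?thesis using i edge by (simp add: insert_commute)
      qed
    qed
    then have "has_cycle V E"
      using i i2 path unfolding has_cycle_def is_path_def
      by (intro exI[of _ "take (Suc i) xs"]) (auto dest: in_set_takeD)
    then show False using nc by simp
  qed
  ultimately have "i = 1" by simp
  then show ?thesis using i by simp
qed

lemma tree_leaf_exists:
  assumes tree: "is_tree V E" and "r \<in> V" "V \<noteq> {r}"
  obtains x u where "x \<in> V" "x \<noteq> r" "{x, u} \<in> E" "\<And>y. {x, y} \<in> E \<Longrightarrow> y = u"
proof -
  have sg: "simple_graph V E" and fin: "finite V" using tree by (auto simp: is_tree_def simple_graph_def)
  obtain s where s: "s \<in> V" "s \<noteq> r" using assms by blast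
  then have "(\<lambda>x y. {x, y} \<in> E)\<^sup>*\<^sup>* r s"
    using tree \<open>r \<in> V\<close> by (auto simp: is_tree_def connected_graph_def)
  then obtain t where t: "{r, t} \<in> E" using s(2) by (cases rule: converse_rtranclpE) auto
  have p2: "is_path V E [r, t]"
    using simple_graphD[OF sg t] t by (auto simp: is_path_def less_Suc_eq)
  have bound: "\<forall>ys. is_path V E ys \<longrightarrow> length ys < Suc (card V)"
    using card_mono[OF fin] by (auto simp: is_path_def less_Suc_eq_le distinct_card[symmetric])
  have "\<exists>xs. is_path V E xs \<and> (\<forall>ys. is_path V E ys \<longrightarrow> length ys \<le> length xs)"
    by (rule ex_has_greatest_nat[where P = "is_path V E", OF p2 bound])
  then obtain xs where xs: "is_path V E xs" "\<And>ys. is_path V E ys \<Longrightarrow> length ys \<le> length xs"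
    by blast
  then have len: "2 \<le> length xs" using p2 by fastforce
  have ends: "xs ! 0 \<noteq> xs ! (length xs - 1)"
    using xs(1) len by (subst nth_eq_iff_index_eq) (auto simp: is_path_def)
  \<comment> \<open>A longest path has two different ends, so after a possible reversal it starts
    away from \<open>r\<close>.\<close>
  define ys where "ys = (if xs ! 0 = r then rev xs else xs)"
  have ys: "is_path V E ys" "length ys = length xs" using xs is_path_rev by (auto simp: ys_def)
  have "rev xs ! 0 = xs ! (length xs - 1)" using len by (subst rev_nth) auto
  then have "ys ! 0 \<noteq> r" using ends by (auto simp: ys_def)
  moreover have "ys ! 0 \<in> V" using ys len nth_mem[of 0 ys] unfolding is_path_def by fastforce
  moreover have "{ys ! 0, ys ! 1} \<in> E" using ys len by (auto simp: is_path_def)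
  moreover have "y = ys ! 1" if "{ys ! 0, y} \<in> E" for y
    using maximal_path_end[OF tree ys(1)] xs(2) ys(2) len that by auto
  ultimately show thesis using that by blast
qed

lemma tree_remove_leaf:
  assumes tree: "is_tree V E" and x: "x \<in> V" "{x, u} \<in> E" and leaf: "\<And>y. {x, y} \<in> E \<Longrightarrow> y = u"
  shows "is_tree (V - {x}) (E - {{x, u}})"
proof -
  have sg: "simple_graph V E" and conn: "connected_graph V E" and nc: "\<not> has_cycle V E"
    using tree by (auto simp: is_tree_def)
  note u = simple_graphD[OF sg x(2)]
  have "simple_graph (V - {x}) (E - {{x, u}})"
    unfolding simple_graph_def
  proof (intro conjI ballI)
    fix e assume e: "e \<in> E - {{x, u}}"
    then obtain a b where ab: "a \<in> V" "b \<in> V" "a \<noteq> b" "e = {a, b}"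
      using sg unfolding simple_graph_def by blast
    then have "a \<noteq> x" "b \<noteq> x" using e leaf[of a] leaf[of b] by (auto simp: insert_commute)
    then show "\<exists>u v. u \<in> V - {x} \<and> v \<in> V - {x} \<and> u \<noteq> v \<and> e = {u, v}" using ab by blast
  qed (use sg in \<open>auto simp: simple_graph_def\<close>)
  moreover have "\<not> has_cycle (V - {x}) (E - {{x, u}})"
    using nc unfolding has_cycle_def by blast
  moreover have "connected_graph (V - {x}) (E - {{x, u}})"
    unfolding connected_graph_def
  proof (intro conjI ballI)
    show "V - {x} \<noteq> {}" using u by auto
    fix a b assume a: "a \<in> V - {x}" and b: "b \<in> V - {x}"
    have "(\<lambda>x y. {x, y} \<in> E)\<^sup>*\<^sup>* a b" using conn a b by (auto simp: connected_graph_def)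
    \<comment> \<open>A walk can visit \<open>x\<close> only as a detour from \<open>u\<close> and
      back. The induction keeps the walk waiting at \<open>u\<close> while the original one is at
      \<open>x\<close>.\<close>
    then have "(\<lambda>y z. {y, z} \<in> E - {{x, u}})\<^sup>*\<^sup>* a (if b = x then u else b)"
    proof induction
      case (step y z)
      show ?case
      proof (cases "y = x \<or> z = x")
        case True
        then show ?thesis using step leaf[of y] leaf[of z] u(3) by (auto simp: insert_commute)
      next
        case False
        then have "{y, z} \<in> E - {{x, u}}" using step by (auto simp: doubleton_eq_iff)
        then show ?thesis using False step.IH by (auto intro: rtranclp.rtrancl_into_rtrancl)
      qed
    qed (use a in auto)
    then show "(\<lambda>y z. {y, z} \<in> E - {{x, u}})\<^sup>*\<^sup>* a b" using b by auto
  qed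
  ultimately show ?thesis by (simp add: is_tree_def)
qed

text \<open>\<open>dep w\<close> is the distance from the root, and \<open>br w\<close> the neighbour of the root through which
  the path from the root to \<open>w\<close> passes.\<close>
locale rooted_tree =
  fixes V :: "'a set" and E :: "'a set set" and r :: 'a
    and par :: "'a \<Rightarrow> 'a" and dep :: "'a \<Rightarrow> nat" and br :: "'a \<Rightarrow> 'a"
  assumes finite_V: "finite V" and root: "r \<in> V"
    and edges: "E = (\<lambda>w. {w, par w}) ` (V - {r})"
    and par_V: "w \<in> V - {r} \<Longrightarrow> par w \<in> V"
    and dep_root: "dep r = 0"
    and dep_par: "w \<in> V - {r} \<Longrightarrow> dep w = Suc (dep (par w))"
    and br_eq: "w \<in> V - {r} \<Longrightarrow> br w = (if par w = r then w else br (par w))"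

text \<open>Induction on the number of vertices: remove a leaf other than \<open>r\<close>, root the
  remaining tree at \<open>r\<close>, and hang the leaf below its only neighbour.\<close>

lemma tree_rooted:
  assumes "is_tree V E" "r \<in> V"
  shows "\<exists>par dep br. rooted_tree V E r par dep br"
  using assms
proof (induction "card V" arbitrary: V E rule: less_induct)
  case less
  then have sg: "simple_graph V E" and fin: "finite V"
    by (auto simp: is_tree_def simple_graph_def)
  show ?case
  proof (cases "V = {r}")
    case True
    then have "E = {}" using sg by (auto simp: simple_graph_def)
    then have "rooted_tree V E r (\<lambda>_. r) (\<lambda>_. 0) (\<lambda>_. r)"
      using True by unfold_locales auto
    then show ?thesis by blast
  next
    case False
    obtain x u where x: "x \<in> V" "x \<noteq> r" "{x, u} \<in> E" "\<And>y. {x, y} \<in> E \<Longrightarrow> y = u"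
      using tree_leaf_exists[OF less.prems False] by blast
    note u = simple_graphD[OF sg x(3)]
    obtain par dep br where "rooted_tree (V - {x}) (E - {{x, u}}) r par dep br"
      using less.hyps[OF _ tree_remove_leaf[OF less.prems(1) x(1,3,4)]] less.prems x fin
      by (metis Diff_iff card_Diff1_less singletonD)
    then interpret T: rooted_tree "V - {x}" "E - {{x, u}}" r par dep br .
    \<comment> \<open>No other vertex has \<open>x\<close> as parent, so updating the three
      functions at \<open>x\<close> keeps the equations at all other vertices.\<close>
    have parx: "par w \<noteq> x" if "w \<in> V - {r}" "w \<noteq> x" for w
      using T.par_V[of w] that by auto
    have "rooted_tree V E r (par(x := u)) (dep(x := Suc (dep u))) (br(x := if u = r then x else br u))"
    proof
      show "E = (\<lambda>w. {w, (par(x := u)) w}) ` (V - {r})"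
      proof -
        have "E = insert {x, u} ((\<lambda>w. {w, par w}) ` (V - {x} - {r}))" using T.edges[symmetric] x(3) by auto
        also have "\<dots> = (\<lambda>w. {w, (par(x := u)) w}) ` insert x (V - {x} - {r})"
          by auto
        also have "insert x (V - {x} - {r}) = V - {r}" using x by auto
        finally show ?thesis .
      qed
      fix w assume w: "w \<in> V - {r}"
      show "(par(x := u)) w \<in> V" using w u T.par_V[of w] by auto
      show "(dep(x := Suc (dep u))) w = Suc ((dep(x := Suc (dep u))) ((par(x := u)) w))"
        using w u parx[of w] T.dep_par[of w] by auto
      show "(br(x := if u = r then x else br u)) w = (if (par(x := u)) w = r then w
          else (br(x := if u = r then x else br u)) ((par(x := u)) w))"
      proof (cases "w = x")
        case True
        then show ?thesis using u by simp
      next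
        case False
        then show ?thesis using w parx[of w] T.br_eq[of w] by simp
      qed
    qed (use fin less.prems(2) x(2) T.dep_root in simp_all)
    then show ?thesis by blast
  qed
qed

section \<open>Counting edges through the parent map\<close>

context rooted_tree
begin

definition children :: "'a \<Rightarrow> 'a set" where
  "children u = {w \<in> V - {r}. par w = u}"

lemma finite_children [simp]: "finite (children u)"
  using finite_V by (simp add: children_def)

lemma par_neq: "w \<in> V - {r} \<Longrightarrow> par w \<noteq> w"
  using dep_par[of w] by auto

text \<open>The vertices other than the root index the edges: two of them with the same parent edge
  would be parents of each other, which their depths forbid.\<close>

lemma inj_on_parent_edge: "inj_on (\<lambda>w. {w, par w}) (V - {r})"
proof (rule inj_onI)
  fix w w' assume w: "w \<in> V - {r}" and w': "w' \<in> V - {r}" and "{w, par w} = {w', par w'}"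
  then consider "w = w'" | "w = par w'" "w' = par w" by (auto simp: doubleton_eq_iff)
  then show "w = w'"
  proof cases
    case 2
    have "dep w = Suc (dep w')" "dep w' = Suc (dep w)"
      using dep_par[OF w] dep_par[OF w'] by (simp_all flip: 2)
    then show ?thesis by simp
  qed
qed

lemma degree_eq:
  assumes "u \<in> V"
  shows "degree E u = card (children u) + (if u = r then 0 else 1)"
proof -
  have "{e \<in> E. u \<in> e} = (\<lambda>w. {w, par w}) ` (children u \<union> ({u} - {r}))"
    using assms by (auto simp: edges children_def)
  moreover have "inj_on (\<lambda>w. {w, par w}) (children u \<union> ({u} - {r}))"
    using inj_on_parent_edge by (rule inj_on_subset) (use assms in \<open>auto simp: children_def\<close>)
  ultimately have "degree E u = card (children u \<union> ({u} - {r}))"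
    by (simp add: degree_def card_image)
  also have "\<dots> = card (children u) + card ({u} - {r})"
    using par_neq by (intro card_Un_disjoint finite_children) (auto simp: children_def)
  finally show ?thesis by auto
qed

lemma chi_eq:
  "chi \<alpha> E = (\<Sum>w\<in>V - {r}. (real (degree E w) + real (degree E (par w))) powr \<alpha>)"
proof -
  have "chi \<alpha> E = (\<Sum>w\<in>V - {r}. (\<Sum>v\<in>{w, par w}. real (degree E v)) powr \<alpha>)"
    unfolding chi_def by (subst (1) edges) (simp add: sum.reindex[OF inj_on_parent_edge])
  also have "\<dots> = (\<Sum>w\<in>V - {r}. (real (degree E w) + real (degree E (par w))) powr \<alpha>)"
    using par_neq by (intro sum.cong) (auto simp: eq_commute)
  finally show ?thesis .
qed

lemma children_root_subset: "children r \<subseteq> V - {r}"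
  by (auto simp: children_def)

text \<open>Edges not at the root are grouped by their upper endpoint \<open>u\<close>, which has
  \<open>degree E u - 1\<close> children. This moves losses from edges to vertices, and with
  \<open>g\<close> constant 1 it counts the vertices of depth at least 2.\<close>

lemma sum_grandchildren:
  fixes g :: "'a \<Rightarrow> real"
  shows "(\<Sum>w\<in>V - {r} - children r. g (par w)) = (\<Sum>u\<in>V - {r}. (real (degree E u) - 1) * g u)"
proof -
  have "(\<Sum>w\<in>V - {r} - children r. g (par w))
      = (\<Sum>u\<in>V - {r}. \<Sum>w\<in>{w. w \<in> V - {r} - children r \<and> par w = u}. g (par w))"
    using finite_V par_V by (intro sum.group[symmetric]) (auto simp: children_def)
  also have "\<dots> = (\<Sum>u\<in>V - {r}. \<Sum>w\<in>children u. g u)"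
    by (intro sum.cong) (auto simp: children_def)
  also have "\<dots> = (\<Sum>u\<in>V - {r}. (real (degree E u) - 1) * g u)"
    by (intro sum.cong) (auto simp: degree_eq)
  finally show ?thesis .
qed

lemma degree_pos: "w \<in> V - {r} \<Longrightarrow> 1 \<le> degree E w"
  by (simp add: degree_eq)

lemma degree_parent: "w \<in> V - {r} \<Longrightarrow> w \<notin> children r \<Longrightarrow> 2 \<le> degree E (par w)"
proof -
  assume w: "w \<in> V - {r}" "w \<notin> children r"
  then have "w \<in> children (par w)" "par w \<noteq> r" by (auto simp: children_def)
  then have "0 < card (children (par w))" by (auto simp: card_gt_0_iff)
  then show ?thesis using w par_V \<open>par w \<noteq> r\<close> by (auto simp: degree_eq)
qed

end

section \<open>The upper bound\<close>

text \<open>\<open>a\<close> and \<open>D\<close> are the degrees of the lower and the upper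
  endpoint, and the loss subtracted depends on \<open>D\<close> alone. For a leaf the claim compares
  the drop at \<open>D + 1\<close> with the drop at 3; for \<open>a \<ge> 2\<close> it is
  monotonicity.\<close>

lemma edge_weight_le:
  fixes a D :: nat
  assumes "\<alpha> < 0" "1 \<le> a" "2 \<le> D"
  shows "(real a + real D) powr \<alpha>
    \<le> (if a = 1 then 3 powr \<alpha> else 4 powr \<alpha>) - (4 powr \<alpha> - (real D + 2) powr \<alpha>)"
proof (cases "a = 1")
  case True
  have "(real D + 1) powr \<alpha> - (real D + 1 + 1) powr \<alpha> \<le> 3 powr \<alpha> - (3 + 1) powr \<alpha>"
    using powr_diff_strict_antimono[of \<alpha> 3 "real D + 1"] assms
    by (cases "D = 2") auto
  then show ?thesis using True by (simp add: add.commute)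
next
  case False
  then have "(real a + real D) powr \<alpha> \<le> (real D + 2) powr \<alpha>"
    using assms by (intro powr_mono2') auto
  then show ?thesis using False by simp
qed

lemma edge_weight_less:
  fixes a D :: nat
  assumes "\<alpha> < 0" "3 \<le> a"
  shows "(real a + real D) powr \<alpha> < (real D + 2) powr \<alpha>"
  using assms by (intro powr_less_mono2_neg) auto

text \<open>The left side is the base weight of the edge above a vertex minus the losses of its
  child edges. The right side is linear in \<open>d\<close>, so its sum over the tree is known from
  the number of vertices and the degree of the root. Both sides agree for \<open>d = 1\<close> and
  \<open>d = 2\<close>; in general \<open>d = m + 2\<close> leads to
  \<open>branching_loss\<close>.\<close>

lemma vertex_weight_le:
  fixes d :: nat
  assumes "alpha1 \<le> \<alpha>" "\<alpha> < 0" "1 \<le> d"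
  shows "(if d = 1 then 3 powr \<alpha> else 4 powr \<alpha>) - (real d - 1) * (4 powr \<alpha> - (real d + 2) powr \<alpha>)
    \<le> 4 powr \<alpha> + (2 - real d) * (3 powr \<alpha> - 4 powr \<alpha>)"
proof (cases "d = 1")
  case False
  then obtain m where m: "d = m + 2"
    using assms(3) by (metis Suc_eq_plus1 add_2_eq_Suc' le_Suc_ex One_nat_def plus_1_eq_Suc not0_implies_Suc add_0_right)
  then show ?thesis
    using branching_loss[OF assms(1,2), of m] by (simp add: algebra_simps)
qed simp

context rooted_tree
begin

definition inner_children :: "'a set" where
  "inner_children = {w \<in> children r. 2 \<le> degree E w}"

lemma degree_root: "degree E r = card (children r)"
  using root by (simp add: degree_eq)

lemma card_nonroot: "real (card (V - {r})) = real (card V) - 1"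
  using arg_cong[OF card.remove[OF finite_V root], of real] by (simp only: of_nat_Suc)

lemma card_grandchildren:
  "real (card (V - {r} - children r)) = real (card V) - 1 - real (degree E r)"
  using card_Diff_subset[OF finite_children children_root_subset]
    card_mono[OF _ children_root_subset] finite_V card_nonroot
  by (simp add: degree_root of_nat_diff)

lemma sum_degree_nonroot:
  "(\<Sum>u\<in>V - {r}. real (degree E u) - 1) = real (card V) - 1 - real (degree E r)"
  using sum_grandchildren[of "\<lambda>_. 1"] card_grandchildren by simp

text \<open>Each inner child has a child of its own, and only \<open>card V - 1 - degree E r\<close>
  vertices lie beyond the root and its neighbours; the sum of \<open>degree - 1\<close> counts
  them.\<close>

lemma card_inner_children_le:
  "card inner_children \<le> degree E r"
  "real (card inner_children) \<le> real (card V) - 1 - real (degree E r)"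
proof -
  show "card inner_children \<le> degree E r"
    unfolding degree_root inner_children_def by (intro card_mono) auto
  have "real (card inner_children) = (\<Sum>u\<in>inner_children. 1)" by simp
  also have "\<dots> \<le> (\<Sum>u\<in>inner_children. real (degree E u) - 1)"
    by (intro sum_mono) (auto simp: inner_children_def)
  also have "\<dots> \<le> (\<Sum>u\<in>V - {r}. real (degree E u) - 1)"
    using finite_V degree_pos by (intro sum_mono2) (auto simp: inner_children_def children_def)
  finally show "real (card inner_children) \<le> real (card V) - 1 - real (degree E r)"
    using sum_degree_nonroot by simp
qed

text \<open>The index of a spider with these parameters. Edges at the centre start with
  \<open>\<Delta> + 1\<close> and all others with 4 as base of the power; each leg with at least two
  vertices replaces one \<open>\<Delta> + 1\<close> by \<open>\<Delta> + 2\<close> and, at its tip,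
  one 4 by 3.\<close>

definition spider_chi :: "real \<Rightarrow> real" where
  "spider_chi \<alpha> = (real (card V) - 1 - real (degree E r)) * 4 powr \<alpha>
     + real (degree E r) * (real (degree E r) + 1) powr \<alpha>
     + real (card inner_children) * (3 powr \<alpha> - 4 powr \<alpha>
         - (real (degree E r) + 1) powr \<alpha> + (real (degree E r) + 2) powr \<alpha>)"

text \<open>An edge inside the tree is charged with the loss caused by its upper endpoint only, so that the
  losses add up vertex by vertex.\<close>
definition edge_bound :: "real \<Rightarrow> 'a \<Rightarrow> real" where
  "edge_bound \<alpha> w =
    (if w \<in> children r
     then if degree E w = 1 then (real (degree E r) + 1) powr \<alpha> else (real (degree E r) + 2) powr \<alpha>
     else (if degree E w = 1 then 3 powr \<alpha> else 4 powr \<alpha>)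
       - (4 powr \<alpha> - (real (degree E (par w)) + 2) powr \<alpha>))"

text \<open>The total charge is the spider value plus one correction per vertex, and each correction
  is the difference of the two sides in \<open>vertex_weight_le\<close>.\<close>

lemma sum_edge_bound:
  "(\<Sum>w\<in>V - {r}. edge_bound \<alpha> w) = spider_chi \<alpha> + (\<Sum>w\<in>V - {r}.
      ((if degree E w = 1 then 3 powr \<alpha> else 4 powr \<alpha>)
        - (real (degree E w) - 1) * (4 powr \<alpha> - (real (degree E w) + 2) powr \<alpha>))
      - (4 powr \<alpha> + (2 - real (degree E w)) * (3 powr \<alpha> - 4 powr \<alpha>)))"
proof -
  define f where "f = (\<lambda>x::real. x powr \<alpha>)"
  define base where "base = (\<lambda>w. if degree E w = 1 then f 3 else f 4)"
  define top where "top = (\<lambda>w. if degree E w = 1 then f (real (degree E r) + 1) else f (real (degree E r) + 2))"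
  define loss where "loss = (\<lambda>w. f 4 - f (real (degree E w) + 2))"
  have fin: "finite (V - {r})" using finite_V by simp
  note split = sum.subset_diff[OF children_root_subset fin]
  have "(\<Sum>w\<in>V - {r}. edge_bound \<alpha> w)
      = (\<Sum>w\<in>V - {r} - children r. base w - loss (par w)) + (\<Sum>w\<in>children r. top w)"
    unfolding split[of "edge_bound \<alpha>"]
    by (intro arg_cong2[where f = "(+)"] sum.cong)
      (auto simp: edge_bound_def base_def top_def loss_def f_def)
  \<comment> \<open>The sum of \<open>base\<close> is completed to all edges, at the price of
    \<open>top - base\<close> at the root, and the losses are regrouped by
    \<open>sum_grandchildren\<close>.\<close>
  also have "\<dots> = (\<Sum>w\<in>V - {r}. base w - (real (degree E w) - 1) * loss w)
      + (\<Sum>w\<in>children r. top w - base w)"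
    using split[of base] sum_grandchildren[of loss] by (simp add: sum_subtractf)
  also have "(\<Sum>w\<in>children r. top w - base w)
      = real (card inner_children) * (f (real (degree E r) + 2) - f 4)
       + (real (degree E r) - real (card inner_children)) * (f (real (degree E r) + 1) - f 3)"
  proof -
    have sub: "inner_children \<subseteq> children r" by (auto simp: inner_children_def)
    have one: "degree E w = 1" if "w \<in> children r - inner_children" for w
    proof -
      have w: "w \<in> V - {r}" using that children_root_subset by blast
      have "\<not> 2 \<le> degree E w" using that by (simp add: inner_children_def)
      then show ?thesis using degree_pos[OF w] by linarith
    qed
    have "(\<Sum>w\<in>children r. top w - base w)
        = (\<Sum>w\<in>children r - inner_children. f (real (degree E r) + 1) - f 3)
        + (\<Sum>w\<in>inner_children. f (real (degree E r) + 2) - f 4)"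
    proof -
      have "top w - base w = f (real (degree E r) + 1) - f 3" if "w \<in> children r - inner_children" for w
        using one[OF that] by (simp add: top_def base_def)
      moreover have "top w - base w = f (real (degree E r) + 2) - f 4" if "w \<in> inner_children" for w
        using that by (simp add: inner_children_def top_def base_def)
      ultimately show ?thesis
        unfolding sum.subset_diff[OF sub finite_children]
        by (intro arg_cong2[where f = "(+)"] sum.cong) auto
    qed
    moreover have "real (card (children r - inner_children)) = real (degree E r) - real (card inner_children)"
      using card_Diff_subset[OF finite_subset[OF sub finite_children] sub] card_inner_children_le(1)
      by (simp add: degree_root of_nat_diff)
    ultimately show ?thesis by simp
  qed
  also have "(\<Sum>w\<in>V - {r}. base w - (real (degree E w) - 1) * loss w)
      = (\<Sum>w\<in>V - {r}. f 4 + (2 - real (degree E w)) * (f 3 - f 4))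
       + (\<Sum>w\<in>V - {r}. (base w - (real (degree E w) - 1) * loss w)
           - (f 4 + (2 - real (degree E w)) * (f 3 - f 4)))"
    by (simp add: sum_subtractf)
  \<comment> \<open>Each linear term equals \<open>f 3 - (degree - 1) * (f 3 - f 4)\<close>, and the
    sum of \<open>degree - 1\<close> is known.\<close>
  also have "(\<Sum>w\<in>V - {r}. f 4 + (2 - real (degree E w)) * (f 3 - f 4))
      = (\<Sum>w\<in>V - {r}. f 3) - (\<Sum>w\<in>V - {r}. real (degree E w) - 1) * (f 3 - f 4)"
    unfolding sum_distrib_right sum_subtractf[symmetric] by (intro sum.cong) (auto simp: algebra_simps)
  also have "\<dots> = (real (card V) - 1) * f 3 - (real (card V) - 1 - real (degree E r)) * (f 3 - f 4)"
    using sum_degree_nonroot card_nonroot by simp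
  finally show ?thesis
    unfolding base_def loss_def spider_chi_def unfolding f_def by (simp add: algebra_simps)
qed

lemma edge_le_edge_bound:
  assumes "\<alpha> < 0" "w \<in> V - {r}"
  shows "(real (degree E w) + real (degree E (par w))) powr \<alpha> \<le> edge_bound \<alpha> w"
    and "3 \<le> degree E w \<Longrightarrow> (real (degree E w) + real (degree E (par w))) powr \<alpha> < edge_bound \<alpha> w"
proof -
  have d: "1 \<le> degree E w" using degree_pos assms by simp
  \<comment> \<open>For \<open>w\<close> of degree at least 2 both branches of
    \<open>edge_bound\<close> reduce to the power of the degree of the parent plus 2.\<close>
  have lt: "(real (degree E w) + real (degree E (par w))) powr \<alpha> < edge_bound \<alpha> w" if "3 \<le> degree E w"
    using edge_weight_less[OF assms(1) that, of "degree E (par w)"] that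
    by (auto simp: edge_bound_def children_def)
  show "(real (degree E w) + real (degree E (par w))) powr \<alpha> \<le> edge_bound \<alpha> w"
  proof (cases "w \<in> children r")
    case True
    then have "par w = r" by (simp add: children_def)
    moreover have "degree E w = 1 \<or> degree E w = 2 \<or> 3 \<le> degree E w" using d by linarith
    ultimately show ?thesis using lt True by (auto simp: edge_bound_def add.commute)
  next
    case False
    then show ?thesis
      using edge_weight_le[OF assms(1) d degree_parent[OF assms(2) False]]
      by (auto simp: edge_bound_def)
  qed
  show "3 \<le> degree E w \<Longrightarrow> (real (degree E w) + real (degree E (par w))) powr \<alpha> < edge_bound \<alpha> w"
    by (rule lt)
qed

lemma edge_bound_sum_le:
  assumes "alpha1 \<le> \<alpha>" "\<alpha> < 0"
  shows "(\<Sum>w\<in>V - {r}. edge_bound \<alpha> w) \<le> spider_chi \<alpha>"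
proof -
  have "(\<Sum>w\<in>V - {r}.
      ((if degree E w = 1 then 3 powr \<alpha> else 4 powr \<alpha>)
        - (real (degree E w) - 1) * (4 powr \<alpha> - (real (degree E w) + 2) powr \<alpha>))
      - (4 powr \<alpha> + (2 - real (degree E w)) * (3 powr \<alpha> - 4 powr \<alpha>))) \<le> 0"
    using vertex_weight_le[OF assms degree_pos] by (intro sum_nonpos) (simp only: diff_le_0_iff_le)
  then show ?thesis unfolding sum_edge_bound by linarith
qed

lemma chi_le_spider_chi:
  assumes "alpha1 \<le> \<alpha>" "\<alpha> < 0"
  shows "chi \<alpha> E \<le> spider_chi \<alpha>"
proof -
  have "chi \<alpha> E \<le> (\<Sum>w\<in>V - {r}. edge_bound \<alpha> w)"
    unfolding chi_eq using edge_le_edge_bound(1)[OF assms(2)] by (intro sum_mono)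
  then show ?thesis using edge_bound_sum_le[OF assms] by linarith
qed

lemma chi_less_spider_chi:
  assumes "alpha1 \<le> \<alpha>" "\<alpha> < 0" "w \<in> V - {r}" "3 \<le> degree E w"
  shows "chi \<alpha> E < spider_chi \<alpha>"
proof -
  have "chi \<alpha> E < (\<Sum>w\<in>V - {r}. edge_bound \<alpha> w)"
    unfolding chi_eq using edge_le_edge_bound[OF assms(2)] assms(3,4) finite_V
    by (intro sum_strict_mono_ex1) auto
  then show ?thesis using edge_bound_sum_le[OF assms(1,2)] by linarith
qed

text \<open>All estimates are tight here: parents of vertices outside \<open>children r\<close> have
  degree exactly 2, and the corrections in \<open>sum_edge_bound\<close> vanish for degrees 1 and
  2.\<close>

lemma chi_eq_spider_chi:
  assumes "\<And>w. w \<in> V - {r} \<Longrightarrow> degree E w \<le> 2"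
  shows "chi \<alpha> E = spider_chi \<alpha>"
proof -
  have d: "degree E w = 1 \<or> degree E w = 2" if "w \<in> V - {r}" for w
    using assms[OF that] degree_pos[OF that] by linarith
  have "chi \<alpha> E = (\<Sum>w\<in>V - {r}. edge_bound \<alpha> w)"
    unfolding chi_eq
  proof (intro sum.cong refl)
    fix w assume w: "w \<in> V - {r}"
    show "(real (degree E w) + real (degree E (par w))) powr \<alpha> = edge_bound \<alpha> w"
    proof (cases "w \<in> children r")
      case True
      then have "par w = r" by (simp add: children_def)
      then show ?thesis using d[OF w] True by (auto simp: edge_bound_def add.commute)
    next
      case False
      then have "par w \<in> V - {r}" using w par_V by (auto simp: children_def)
      then have "degree E (par w) = 2" using d degree_parent[OF w False] by fastforce
      then show ?thesis using d[OF w] False by (auto simp: edge_bound_def)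
    qed
  qed
  also have "\<dots> = spider_chi \<alpha>"
    unfolding sum_edge_bound using d by (subst sum.neutral) fastforce+
  finally show ?thesis .
qed

end

section \<open>Spiders\<close>

lemma degree_eq_card_neighbours:
  assumes "simple_graph V E"
  shows "degree E v = card {u. {v, u} \<in> E}"
proof -
  have "{e \<in> E. v \<in> e} = (\<lambda>u. {v, u}) ` {u. {v, u} \<in> E}"
  proof (intro equalityI subsetI)
    fix e assume e: "e \<in> {e \<in> E. v \<in> e}"
    then obtain a b where "e = {a, b}" using assms unfolding simple_graph_def by blast
    then show "e \<in> (\<lambda>u. {v, u}) ` {u. {v, u} \<in> E}" using e by (auto simp: insert_commute)
  qed auto
  moreover have "inj_on (\<lambda>u. {v, u}) {u. {v, u} \<in> E}"
    by (auto simp: inj_on_def doubleton_eq_iff)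
  ultimately show ?thesis by (simp add: degree_def card_image)
qed

lemma spider_E_I:
  "j < length ls \<Longrightarrow> 1 \<le> ls ! j \<Longrightarrow> {(Suc j, 1), (0, 0)} \<in> spider_E ls"
  "j < length ls \<Longrightarrow> 1 \<le> i \<Longrightarrow> Suc i \<le> ls ! j \<Longrightarrow> {(Suc j, Suc i), (Suc j, i)} \<in> spider_E ls"
  unfolding spider_E_def by blast+

lemma spider_neighbours_centre:
  assumes "\<forall>l\<in>set ls. 1 \<le> l"
  shows "{y \<in> spider_V ls. {(0, 0), y} \<in> spider_E ls} = (\<lambda>j. (Suc j, 1)) ` {..<length ls}"
  using assms by (auto simp: spider_V_def spider_E_def doubleton_eq_iff)

text \<open>Only an inclusion, since the outermost vertex of a leg has no outer neighbour; it bounds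
  the degree by 2.\<close>

lemma spider_neighbours_leg:
  "{y \<in> spider_V ls. {(Suc j, i), y} \<in> spider_E ls}
    \<subseteq> {(Suc j, Suc i), if i = 1 then (0, 0) else (Suc j, i - 1)}"
  by (auto simp: spider_V_def spider_E_def doubleton_eq_iff)

text \<open>Carries the centre of the spider back to the tree, in the form that
  \<open>chi_spider\<close> expects. For the number of non-leaf neighbours a lower bound suffices,
  because \<open>card_inner_children_le_min\<close> bounds it from above.\<close>

lemma spider_iso_centre:
  assumes tree: "is_tree V E" and iso: "graph_iso V E (spider_V ls) (spider_E ls)"
    and ls: "\<forall>l\<in>set ls. 1 \<le> l"
  obtains v where "v \<in> V" "degree E v = length ls" "\<And>w. w \<in> V - {v} \<Longrightarrow> degree E w \<le> 2"
    "card {j. j < length ls \<and> 2 \<le> ls ! j} \<le> card {w. {v, w} \<in> E \<and> 2 \<le> degree E w}"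
proof -
  have sg: "simple_graph V E" and fin: "finite V" using tree by (auto simp: is_tree_def simple_graph_def)
  obtain f where f: "bij_betw f V (spider_V ls)"
    and fE: "\<And>u v. u \<in> V \<Longrightarrow> v \<in> V \<Longrightarrow> {u, v} \<in> E \<longleftrightarrow> {f u, f v} \<in> spider_E ls"
    using iso unfolding graph_iso_def by blast
  define g where "g = inv_into V f"
  have g: "g y \<in> V" "f (g y) = y" if "y \<in> spider_V ls" for y
    using that f bij_betw_inv_into_right[OF f] bij_betwE[OF bij_betw_inv_into[OF f]]
    by (auto simp: g_def)
  have deg: "degree E v = card {y \<in> spider_V ls. {f v, y} \<in> spider_E ls}" if v: "v \<in> V" for v
  proof -
    have "f ` {u. {v, u} \<in> E} = {y \<in> spider_V ls. {f v, y} \<in> spider_E ls}"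
    proof (intro equalityI subsetI)
      fix y assume y: "y \<in> {y \<in> spider_V ls. {f v, y} \<in> spider_E ls}"
      then have "{v, g y} \<in> E" using g[of y] fE[OF v, of "g y"] by simp
      then show "y \<in> f ` {u. {v, u} \<in> E}" using g[of y] y by (intro image_eqI[of _ _ "g y"]) auto
    next
      fix y assume "y \<in> f ` {u. {v, u} \<in> E}"
      then obtain u where u: "{v, u} \<in> E" "y = f u" by blast
      then have "u \<in> V" using simple_graphD(2)[OF sg] by blast
      then show "y \<in> {y \<in> spider_V ls. {f v, y} \<in> spider_E ls}"
        using u fE[OF v] bij_betwE[OF f] by simp
    qed
    moreover have "inj_on f {u. {v, u} \<in> E}"
      using simple_graphD(2)[OF sg] by (intro inj_on_subset[OF bij_betw_imp_inj_on[OF f]]) blast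
    ultimately show ?thesis using degree_eq_card_neighbours[OF sg] by (metis card_image)
  qed
  have c: "(0, 0) \<in> spider_V ls" by (simp add: spider_V_def)
  show thesis
  proof
    show v: "g (0, 0) \<in> V" using g c by simp
    show "degree E (g (0, 0)) = length ls"
      using deg[OF v] g[OF c] by (simp only: spider_neighbours_centre[OF ls]) (simp add: card_image inj_on_def)
    show "degree E w \<le> 2" if w: "w \<in> V - {g (0, 0)}" for w
    proof -
      have "f w \<in> spider_V ls" using f w by (auto dest: bij_betwE)
      moreover have "f w \<noteq> (0, 0)"
        using bij_betw_inv_into_left[OF f, of w] w by (auto simp: g_def)
      ultimately obtain j i where ji: "f w = (Suc j, i)" by (auto simp: spider_V_def)
      have "degree E w = card {y \<in> spider_V ls. {(Suc j, i), y} \<in> spider_E ls}" using deg[of w] w ji by simp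
      also have "\<dots> \<le> card {(Suc j, Suc i), if i = 1 then (0, 0) else (Suc j, i - 1)}"
        by (intro card_mono spider_neighbours_leg) simp
      also have "\<dots> \<le> 2" by (simp add: card_insert_if)
      finally show ?thesis .
    qed
    let ?J = "{j. j < length ls \<and> 2 \<le> ls ! j}"
    show "card ?J \<le> card {w. {g (0, 0), w} \<in> E \<and> 2 \<le> degree E w}"
    proof (rule card_inj_on_le)
      have inV: "(Suc j, 1) \<in> spider_V ls" if "j \<in> ?J" for j
        using that by (auto simp: spider_V_def)
      show "inj_on (\<lambda>j. g (Suc j, 1)) ?J"
      proof (rule inj_onI)
        fix j k assume "j \<in> ?J" "k \<in> ?J" "g (Suc j, 1) = g (Suc k, 1)"
        then have "(Suc j, 1::nat) = (Suc k, 1)" using g(2) inV by metis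
        then show "j = k" by simp
      qed
      show "(\<lambda>j. g (Suc j, 1)) ` ?J \<subseteq> {w. {g (0, 0), w} \<in> E \<and> 2 \<le> degree E w}"
      proof (intro image_subsetI CollectI conjI)
        fix j assume j: "j \<in> ?J"
        then have "{(0, 0), (Suc j, 1)} \<in> spider_E ls" by (auto simp: spider_E_def)
        then show "{g (0, 0), g (Suc j, 1)} \<in> E" using fE[of "g (0, 0)" "g (Suc j, 1)"] g inV[OF j] c by simp
        have "card {(0::nat, 0::nat), (Suc j, 2)} \<le> card {y \<in> spider_V ls. {(Suc j, 1), y} \<in> spider_E ls}"
        proof (rule card_mono)
          show "finite {y \<in> spider_V ls. {(Suc j, 1), y} \<in> spider_E ls}"
            using bij_betw_finite[OF f] fin by simp
          show "{(0, 0), (Suc j, 2)} \<subseteq> {y \<in> spider_V ls. {(Suc j, 1), y} \<in> spider_E ls}"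
            using j by (auto simp: spider_V_def spider_E_def doubleton_eq_iff numeral_2_eq_2)
        qed
        then show "2 \<le> degree E (g (Suc j, 1))" using deg g inV[OF j] by simp
      qed
      have "{w. {g (0, 0), w} \<in> E} \<subseteq> V" using simple_graphD[OF sg] by auto
      then show "finite {w. {g (0, 0), w} \<in> E \<and> 2 \<le> degree E w}"
        using fin by (auto intro: finite_subset[of _ V])
    qed
  qed
qed

section \<open>Rooted trees that branch only at the root\<close>

context rooted_tree
begin

lemma neighbours_root: "{r, w} \<in> E \<longleftrightarrow> w \<in> children r"
  by (auto simp: edges children_def doubleton_eq_iff insert_commute image_iff)

lemma inner_children_eq: "inner_children = {w. {r, w} \<in> E \<and> 2 \<le> degree E w}"
  by (simp add: inner_children_def neighbours_root)

lemma dep_eq_0: "w \<in> V \<Longrightarrow> dep w = 0 \<longleftrightarrow> w = r"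
  using dep_root dep_par[of w] by (cases "w = r") auto

lemma dep_eq_1: "w \<in> V - {r} \<Longrightarrow> dep w = 1 \<longleftrightarrow> w \<in> children r"
  using dep_par[of w] dep_eq_0[OF par_V, of w] by (simp add: children_def)

lemma br_child: "w \<in> children r \<Longrightarrow> br w = w"
  using br_eq[of w] by (simp add: children_def)

lemma br_in_children: "w \<in> V - {r} \<Longrightarrow> br w \<in> children r"
proof (induction "dep w" arbitrary: w rule: less_induct)
  case less
  show ?case
  proof (cases "par w = r")
    case True
    then show ?thesis using less.prems br_eq[of w] by (simp add: children_def)
  next
    case False
    then have "br (par w) \<in> children r"
      using less dep_par[of w] par_V[of w] by simp
    then show ?thesis using br_eq[OF less.prems] False by simp
  qed
qed

lemma ancestor_at_depth:
  "w \<in> V - {r} \<Longrightarrow> 1 \<le> i \<Longrightarrow> i \<le> dep w \<Longrightarrow> \<exists>x\<in>V - {r}. dep x = i \<and> br x = br w"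
proof (induction "dep w" arbitrary: w rule: less_induct)
  case less
  show ?case
  proof (cases "i = dep w")
    case True
    then show ?thesis using less.prems by blast
  next
    case False
    note dw = dep_par[OF less.prems(1)]
    have "par w \<noteq> r" using False less.prems dw dep_root by auto
    then have pw: "par w \<in> V - {r}" "br w = br (par w)"
      using par_V[OF less.prems(1)] br_eq[OF less.prems(1)] by auto
    show ?thesis using less.hyps[of "par w"] pw dw less.prems False by simp
  qed
qed

lemma par_depth_2:
  assumes "w \<in> V - {r}" "dep w = 2"
  shows "par w \<in> children r" "br w = par w" "par w \<in> inner_children"
proof -
  have "dep (par w) = 1" using dep_par[OF assms(1)] assms(2) by simp
  then have p: "par w \<in> V - {r}" using par_V[OF assms(1)] dep_root by auto
  then show c: "par w \<in> children r" using dep_eq_1 \<open>dep (par w) = 1\<close> by simp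
  show "br w = par w" using br_eq[OF assms(1)] br_child[OF c] p by simp
  have "w \<in> children (par w)" using assms by (simp add: children_def)
  then have "0 < card (children (par w))" by (auto simp: card_gt_0_iff)
  then show "par w \<in> inner_children" using c p by (simp add: inner_children_def degree_eq)
qed

lemma depth_2_iff:
  assumes "w \<in> V - {r}"
  shows "dep w = 2 \<longleftrightarrow> par w \<in> children r"
proof
  assume p: "par w \<in> children r"
  then have "dep (par w) = 1" using dep_eq_1 children_root_subset by blast
  then show "dep w = 2" using dep_par[OF assms] by simp
qed (use par_depth_2 assms in blast)

lemma inner_child_has_child:
  assumes "u \<in> inner_children"
  shows "\<exists>w\<in>V - {r}. par w = u"
proof -
  have "u \<in> V - {r}" "2 \<le> degree E u"
    using assms children_root_subset by (auto simp: inner_children_def)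
  then have "0 < card (children u)" by (simp add: degree_eq)
  then have "children u \<noteq> {}" by (simp add: card_gt_0_iff)
  then show ?thesis by (auto simp: children_def)
qed

lemma inner_children_nonempty:
  assumes "degree E r + 1 < card V"
  shows "inner_children \<noteq> {}"
proof -
  have "0 < real (card (V - {r} - children r))" using card_grandchildren assms by linarith
  then have "V - {r} - children r \<noteq> {}" by (metis card.empty of_nat_0 less_irrefl)
  then obtain w where w: "w \<in> V - {r}" "w \<notin> children r" by blast
  then have "2 \<le> dep w" using dep_eq_1[of w] dep_par[of w] by linarith
  then obtain x where "x \<in> V - {r}" "dep x = 2" using ancestor_at_depth[OF w(1), of 2] by auto
  then show ?thesis using par_depth_2 by blast
qed

text \<open>If no vertex other than the root branches, this is the number of vertices of the leg
  that starts at \<open>u\<close>.\<close>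

definition leg :: "'a \<Rightarrow> nat" where
  "leg u = Max (dep ` {w \<in> V - {r}. br w = u})"

text \<open>By \<open>ancestor_at_depth\<close> the depths that occur in a branch have no gaps, so
  their maximum determines them.\<close>

lemma leg_iff:
  assumes u: "u \<in> children r"
  shows "1 \<le> i \<and> i \<le> leg u \<longleftrightarrow> (\<exists>w\<in>V - {r}. br w = u \<and> dep w = i)"
proof -
  let ?D = "dep ` {w \<in> V - {r}. br w = u}"
  have fin: "finite ?D" using finite_V by simp
  have "u \<in> {w \<in> V - {r}. br w = u}" using u br_child children_root_subset by auto
  then have ne: "?D \<noteq> {}" by blast
  show ?thesis
  proof
    assume i: "1 \<le> i \<and> i \<le> leg u"
    obtain w where "w \<in> V - {r}" "br w = u" "dep w = leg u"
      using Max_in[OF fin ne] unfolding leg_def by auto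
    then show "\<exists>w\<in>V - {r}. br w = u \<and> dep w = i" using ancestor_at_depth[of w i] i by auto
  next
    assume "\<exists>w\<in>V - {r}. br w = u \<and> dep w = i"
    then obtain w where w: "w \<in> V - {r}" "br w = u" "dep w = i" by blast
    then have "i \<le> leg u" unfolding leg_def using fin by (intro Max_ge) auto
    then show "1 \<le> i \<and> i \<le> leg u" using w dep_par[of w] by auto
  qed
qed

lemma leg_pos: "u \<in> children r \<Longrightarrow> 1 \<le> leg u"
  using leg_iff[of u 1] dep_eq_1 br_child children_root_subset by blast

lemma leg_ge_2_iff:
  assumes u: "u \<in> children r"
  shows "2 \<le> leg u \<longleftrightarrow> u \<in> inner_children"
proof
  assume "2 \<le> leg u"
  then obtain w where "w \<in> V - {r}" "br w = u" "dep w = 2" using leg_iff[OF u, of 2] by auto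
  then show "u \<in> inner_children" using par_depth_2 by metis
next
  assume i: "u \<in> inner_children"
  obtain w where w: "w \<in> V - {r}" "par w = u" using inner_child_has_child[OF i] by blast
  then have "dep w = 2" using depth_2_iff u by simp
  then show "2 \<le> leg u" using leg_iff[OF u, of 2] w par_depth_2(2)[of w] by auto
qed

text \<open>Branch and depth are coordinates of a vertex: by induction the parents coincide, and a
  parent other than the root has at most one child.\<close>

lemma same_position_eq:
  assumes slim: "\<And>w. w \<in> V - {r} \<Longrightarrow> degree E w \<le> 2"
  shows "w \<in> V - {r} \<Longrightarrow> w' \<in> V - {r} \<Longrightarrow> dep w = dep w' \<Longrightarrow> br w = br w' \<Longrightarrow> w = w'"
proof (induction "dep w" arbitrary: w w' rule: less_induct)
  case less
  note d = dep_par[OF less.prems(1)] dep_par[OF less.prems(2)]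
  show ?case
  proof (cases "par w = r")
    case True
    then have c: "w \<in> children r" using less.prems by (simp add: children_def)
    then have "w' \<in> children r" using less.prems dep_eq_1 by metis
    then show ?thesis using c less.prems(4) br_child by simp
  next
    case False
    then have "par w' \<noteq> r" using d less.prems dep_eq_0[OF par_V] dep_root by (metis Suc_inject)
    then have eq: "par w = par w'"
      using less.hyps[of "par w" "par w'"] False d less.prems par_V br_eq by simp
    have "par w \<in> V - {r}" using False par_V less.prems(1) by blast
    then have "card (children (par w)) \<le> 1" using slim[of "par w"] by (simp add: degree_eq)
    moreover have "{w, w'} \<subseteq> children (par w)" using eq less.prems by (auto simp: children_def)
    ultimately have "card {w, w'} \<le> 1" using card_mono[OF finite_children, of "{w, w'}" "par w"] by linarith
    then show ?thesis by (cases "w = w'") auto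
  qed
qed

text \<open>The isomorphism sends a vertex to its leg number and depth, where \<open>idx\<close>
  matches branches with entries of \<open>ls\<close>. It is injective by
  \<open>same_position_eq\<close> and onto by \<open>leg_iff\<close>.\<close>

lemma iso_spider:
  assumes slim: "\<And>w. w \<in> V - {r} \<Longrightarrow> degree E w \<le> 2"
    and idx: "bij_betw idx (children r) {..<length ls}"
    and legs: "\<And>u. u \<in> children r \<Longrightarrow> ls ! idx u = leg u"
  shows "graph_iso V E (spider_V ls) (spider_E ls)"
proof -
  define \<phi> where "\<phi> w = (if w = r then (0, 0) else (Suc (idx (br w)), dep w))" for w
  have br_idx: "br w = br w'" if "w \<in> V - {r}" "w' \<in> V - {r}" "idx (br w) = idx (br w')" for w w'
    using that idx br_in_children by (meson bij_betw_imp_inj_on inj_onD)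
  have inj: "inj_on \<phi> V"
  proof (rule inj_onI)
    fix w w' assume w: "w \<in> V" "w' \<in> V" "\<phi> w = \<phi> w'"
    then show "w = w'"
      using same_position_eq[OF slim, of w w'] br_idx[of w w'] by (auto simp: \<phi>_def split: if_splits)
  qed
  have leg_idx: "idx (br w) < length ls" "dep w \<le> ls ! idx (br w)" "1 \<le> dep w" if "w \<in> V - {r}" for w
    using br_in_children[OF that] legs idx leg_iff[of "br w" "dep w"] that by (auto dest: bij_betwE)
  have "\<phi> ` V = spider_V ls"
  proof (intro equalityI subsetI)
    fix y assume "y \<in> \<phi> ` V"
    then show "y \<in> spider_V ls" using leg_idx by (auto simp: \<phi>_def spider_V_def)
  next
    fix y assume "y \<in> spider_V ls"
    then consider "y = (0, 0)" | j i where "y = (Suc j, i)" "j < length ls" "1 \<le> i" "i \<le> ls ! j"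
      by (auto simp: spider_V_def)
    then show "y \<in> \<phi> ` V"
    proof cases
      case 1
      then show ?thesis using root by (auto simp: \<phi>_def)
    next
      case 2
      have "idx ` children r = {..<length ls}" using idx by (simp add: bij_betw_def)
      then have "j \<in> idx ` children r" using 2 by simp
      then obtain u where u: "u \<in> children r" "idx u = j" by blast
      then obtain w where "w \<in> V - {r}" "br w = u" "dep w = i"
        using leg_iff[OF u(1), of i] legs[OF u(1)] 2 by auto
      then show ?thesis using u 2 by (auto simp: \<phi>_def)
    qed
  qed
  then have bij: "bij_betw \<phi> V (spider_V ls)" using inj by (simp add: bij_betw_def)
  have par_edge: "{\<phi> w, \<phi> (par w)} \<in> spider_E ls" if w: "w \<in> V - {r}" for w
  proof (cases "par w = r")
    case True
    then have "dep w = 1" using w dep_eq_1 by (simp add: children_def)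
    then have "\<phi> w = (Suc (idx (br w)), 1)" "\<phi> (par w) = (0, 0)"
      using True w by (simp_all add: \<phi>_def)
    then show ?thesis using spider_E_I(1) leg_idx[OF w] by simp
  next
    case False
    then have p: "par w \<in> V - {r}" using par_V w by blast
    have "\<phi> w = (Suc (idx (br w)), Suc (dep (par w)))" "\<phi> (par w) = (Suc (idx (br w)), dep (par w))"
      using False w br_eq[OF w] dep_par[OF w] by (auto simp: \<phi>_def)
    then show ?thesis using spider_E_I(2) leg_idx[OF w] leg_idx(3)[OF p] dep_par[OF w] by simp
  qed
  \<comment> \<open>Stated with \<open>y\<close> as the outer endpoint, so that \<open>x\<close> has
    to be \<open>par y\<close>; along a leg this follows from injectivity, and
    \<open>1 \<le> i\<close> keeps \<open>par y\<close> away from the root.\<close>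
  have edge: "{x, y} \<in> E" if x: "x \<in> V" and y: "y \<in> V"
    and e: "\<phi> x = (0, 0) \<and> \<phi> y = (Suc j, 1) \<or> \<phi> x = (Suc j, i) \<and> \<phi> y = (Suc j, Suc i)" "1 \<le> i" for x y i j
  proof -
    have y': "y \<in> V - {r}" using e y by (auto simp: \<phi>_def)
    have "x = par y"
      using e(1)
    proof (elim disjE conjE)
      assume a: "\<phi> x = (0, 0)" "\<phi> y = (Suc j, 1)"
      then have "dep y = 1" using y' by (simp add: \<phi>_def)
      then have "par y = r" using dep_eq_1[OF y'] by (simp add: children_def)
      moreover have "x = r" using a by (simp add: \<phi>_def split: if_splits)
      ultimately show ?thesis by simp
    next
      assume a: "\<phi> x = (Suc j, i)" "\<phi> y = (Suc j, Suc i)"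
      then have dy: "dep y = Suc i" "idx (br y) = j" using y' by (simp_all add: \<phi>_def)
      then have "dep (par y) = i" using dep_par[OF y'] by simp
      then have p: "par y \<noteq> r" using e(2) dep_root by auto
      then have "\<phi> (par y) = (Suc j, i)" using dy \<open>dep (par y) = i\<close> br_eq[OF y'] by (simp add: \<phi>_def)
      then show ?thesis using inj_onD[OF inj _ x par_V[OF y']] a by simp
    qed
    then show ?thesis using y' unfolding edges by blast
  qed
  have "{x, y} \<in> E \<longleftrightarrow> {\<phi> x, \<phi> y} \<in> spider_E ls" if x: "x \<in> V" and y: "y \<in> V" for x y
  proof
    assume "{x, y} \<in> E"
    then obtain w where "w \<in> V - {r}" "{x, y} = {w, par w}" unfolding edges by blast
    then consider "x \<in> V - {r}" "y = par x" | "y \<in> V - {r}" "x = par y"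
      by (auto simp: doubleton_eq_iff)
    then show "{\<phi> x, \<phi> y} \<in> spider_E ls" using par_edge by cases (auto simp: insert_commute)
  next
    assume "{\<phi> x, \<phi> y} \<in> spider_E ls"
    then consider j where "{\<phi> x, \<phi> y} = {(0, 0), (Suc j, 1)}"
      | j i where "1 \<le> i" "{\<phi> x, \<phi> y} = {(Suc j, i), (Suc j, Suc i)}"
      unfolding spider_E_def by blast
    then show "{x, y} \<in> E"
    proof cases
      case (1 j)
      then show ?thesis
        using edge[OF x y, of j 1] edge[OF y x, of j 1] by (simp add: doubleton_eq_iff insert_commute) blast
    next
      case (2 j i)
      then show ?thesis
        using edge[OF x y, of j i] edge[OF y x, of j i] by (simp add: doubleton_eq_iff insert_commute) blast
    qed
  qed
  then show ?thesis using bij unfolding graph_iso_def by blast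
qed

lemma iso_long_spider:
  assumes slim: "\<And>w. w \<in> V - {r} \<Longrightarrow> degree E w \<le> 2"
    and p: "card inner_children = degree E r"
  shows "\<exists>ls. length ls = degree E r \<and> (\<forall>l\<in>set ls. 2 \<le> l) \<and> graph_iso V E (spider_V ls) (spider_E ls)"
proof -
  have inner: "inner_children = children r"
    using p by (intro card_subset_eq) (auto simp: degree_root inner_children_def)
  obtain us where us: "set us = children r" "distinct us"
    using finite_distinct_list[OF finite_children] by blast
  define idx where "idx = inv_into {..<length us} ((!) us)"
  have b: "bij_betw ((!) us) {..<length us} (children r)" using us bij_betw_nth by blast
  have "graph_iso V E (spider_V (map leg us)) (spider_E (map leg us))"
  proof (rule iso_spider[OF slim])
    show idx: "bij_betw idx (children r) {..<length (map leg us)}"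
      using bij_betw_inv_into[OF b] by (simp add: idx_def)
    show "map leg us ! idx u = leg u" if "u \<in> children r" for u
      using that bij_betwE[OF idx] bij_betw_inv_into_right[OF b that] by (auto simp: idx_def)
  qed
  moreover have "length (map leg us) = degree E r"
    using us distinct_card by (force simp: degree_root)
  ultimately show ?thesis using us inner leg_ge_2_iff by (intro exI[of _ "map leg us"]) auto
qed

lemma iso_T_legs:
  assumes slim: "\<And>w. w \<in> V - {r} \<Longrightarrow> degree E w \<le> 2"
    and p: "card inner_children = card V - degree E r - 1" "degree E r < card V"
  shows "graph_iso V E (spider_V (T_legs (card V) (degree E r))) (spider_E (T_legs (card V) (degree E r)))"
proof -
  let ?n = "card V" and ?\<Delta> = "degree E r"
  let ?m = "2 * ?\<Delta> + 1 - ?n"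
  let ?S = "{w \<in> V - {r}. par w \<in> children r}" and ?Q = "V - {r} - children r"
  have sub: "inner_children \<subseteq> children r" by (auto simp: inner_children_def)
  have fin: "finite inner_children" using finite_subset[OF sub] by simp
  \<comment> \<open>There are at least as many vertices of depth 2 as inner children, and by
    assumption just as many vertices beyond the neighbours of the root. So nothing lies deeper than
    2, and every leg has one or two vertices.\<close>
  have "inner_children \<subseteq> par ` ?S"
  proof
    fix u assume u: "u \<in> inner_children"
    then obtain w where "w \<in> V - {r}" "par w = u" using inner_child_has_child by blast
    then show "u \<in> par ` ?S" using u sub by blast
  qed
  then have "card inner_children \<le> card ?S" using finite_V by (intro surj_card_le) auto
  moreover have "real (card ?Q) = real (card inner_children)"
    using card_grandchildren p by (simp add: of_nat_diff)
  moreover have SQ: "?S \<subseteq> ?Q" using children_root_subset by (auto simp: children_def)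
  ultimately have "?S = ?Q" using finite_V by (intro card_seteq) auto
  then have dep2: "dep w \<le> 2" if "w \<in> V - {r}" for w
    using that depth_2_iff[OF that] dep_eq_1[OF that] by fastforce
  have leg_inner: "leg u = 2" if "u \<in> inner_children" for u
  proof -
    have u: "u \<in> children r" using that sub by blast
    then have l2: "2 \<le> leg u" using leg_ge_2_iff that by simp
    then obtain w where "w \<in> V - {r}" "dep w = leg u" using leg_iff[OF u, of "leg u"] by auto
    then show ?thesis using dep2 l2 by (metis le_antisym)
  qed
  have leg_outer: "leg u = 1" if "u \<in> children r - inner_children" for u
    using that leg_ge_2_iff[of u] leg_pos[of u] by auto
  have card_outer: "card (children r - inner_children) = ?m"
    using card_Diff_subset[OF fin sub] p card_inner_children_le(1) by (simp add: degree_root)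
  obtain h1 where h1: "bij_betw h1 (children r - inner_children) {0..<?m}"
    using ex_bij_betw_finite_nat[of "children r - inner_children"] card_outer by auto
  obtain h2 where h2: "bij_betw h2 inner_children {0..<?n - ?\<Delta> - 1}"
    using ex_bij_betw_finite_nat[OF fin] p by auto
  \<comment> \<open>\<open>T_legs\<close> lists its \<open>?m\<close> legs with one vertex first,
    hence the shift by \<open>?m\<close> for the inner children.\<close>
  define idx where "idx u = (if u \<in> inner_children then ?m + h2 u else h1 u)" for u
  have len: "length (T_legs ?n ?\<Delta>) = ?m + (?n - ?\<Delta> - 1)" by (simp add: T_legs_def)
  have b1: "bij_betw idx (children r - inner_children) {0..<?m}"
    using h1 bij_betw_cong[of "children r - inner_children" idx h1] by (simp add: idx_def)
  have "bij_betw (\<lambda>u. ?m + h2 u) inner_children {?m..<?m + (?n - ?\<Delta> - 1)}"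
  proof -
    have "bij_betw ((+) ?m) {0..<?n - ?\<Delta> - 1} {?m..<?m + (?n - ?\<Delta> - 1)}"
      by (rule bij_betwI[where g = "\<lambda>x. x - ?m"]) auto
    from bij_betw_trans[OF h2 this] show ?thesis by (simp only: comp_def)
  qed
  then have b2: "bij_betw idx inner_children {?m..<?m + (?n - ?\<Delta> - 1)}"
    using bij_betw_cong[of inner_children idx "\<lambda>u. ?m + h2 u"] by (simp add: idx_def)
  have "bij_betw idx ((children r - inner_children) \<union> inner_children) ({0..<?m} \<union> {?m..<?m + (?n - ?\<Delta> - 1)})"
    by (rule bij_betw_combine[OF b1 b2]) auto
  moreover have "(children r - inner_children) \<union> inner_children = children r" using sub by blast
  moreover have "{0..<?m} \<union> {?m..<?m + (?n - ?\<Delta> - 1)} = {..<length (T_legs ?n ?\<Delta>)}"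
    unfolding len by auto
  ultimately have bij: "bij_betw idx (children r) {..<length (T_legs ?n ?\<Delta>)}" by simp
  show ?thesis
  proof (rule iso_spider[OF slim bij])
    fix u assume u: "u \<in> children r"
    show "T_legs ?n ?\<Delta> ! idx u = leg u"
    proof (cases "u \<in> inner_children")
      case True
      then show ?thesis using bij_betwE[OF b2] leg_inner by (fastforce simp: T_legs_def nth_append)
    next
      case False
      then show ?thesis using bij_betwE[OF b1] leg_outer u by (fastforce simp: T_legs_def nth_append)
    qed
  qed
qed

end

section \<open>Optimal spiders\<close>

text \<open>Such a tree has exactly two leaves, neither of them the root. The leaves and their
  parents make up at most four vertices, so a fifth vertex has no leaf as neighbour.\<close>

lemma (in rooted_tree) path_inner_vertex:
  assumes sg: "simple_graph V E" and slim: "\<And>w. w \<in> V \<Longrightarrow> degree E w \<le> 2"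
    and r2: "degree E r = 2" and n: "5 \<le> card V"
  shows "\<exists>v\<in>V. degree E v = 2 \<and> 2 \<le> card {w. {v, w} \<in> E \<and> 2 \<le> degree E w}"
proof -
  define L where "L = {w \<in> V - {r}. degree E w = 1}"
  have fin: "finite L" using finite_V by (simp add: L_def)
  have d: "degree E w = 1 \<or> degree E w = 2" if "w \<in> V - {r}" for w
    using degree_pos[OF that] slim[of w] that by force
  have "real (card L) = (\<Sum>u\<in>V - {r}. if degree E u = 1 then 1 else 0)"
    using finite_V by (simp add: sum.If_cases L_def Int_def)
  \<comment> \<open>For degrees 1 and 2 the linear expression \<open>1 - (degree - 1)\<close> is the
    indicator of a leaf.\<close>
  also have "\<dots> = (\<Sum>u\<in>V - {r}. 1 - (real (degree E u) - 1))"
    using d by (intro sum.cong) fastforce+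
  also have "\<dots> = real (card (V - {r})) - (\<Sum>u\<in>V - {r}. real (degree E u) - 1)"
    by (subst sum_subtractf) simp
  finally have "card L = 2" using sum_degree_nonroot card_nonroot r2 by linarith
  then have "card (L \<union> par ` L) \<le> 4"
    using card_Un_le[of L "par ` L"] card_image_le[OF fin, of par] by linarith
  then obtain v where v: "v \<in> V" "v \<notin> L" "v \<notin> par ` L"
    using n card_mono[of "L \<union> par ` L" V] fin by fastforce
  have v2: "degree E v = 2" using d[of v] v r2 by (auto simp: L_def)
  have "2 \<le> degree E w" if vw: "{v, w} \<in> E" for w
  proof (rule ccontr)
    assume w2: "\<not> 2 \<le> degree E w"
    have "w \<in> V - {r}" using simple_graphD(2)[OF sg vw] w2 r2 by auto
    then have wL: "w \<in> L" using d[of w] w2 by (auto simp: L_def)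
    obtain x where x: "x \<in> V - {r}" "{v, w} = {x, par x}" using vw unfolding edges by blast
    then consider "x = w" "v = par w" | "x = v" "w = par v" by (auto simp: doubleton_eq_iff)
    then show False
    proof cases
      case 2
      then have "v \<in> children w" using x by (simp add: children_def)
      then have "0 < card (children w)" by (auto simp: card_gt_0_iff)
      moreover have "degree E w = 1" using wL by (simp add: L_def)
      moreover have "degree E w = card (children w) + 1"
        using wL degree_eq[of w] by (simp add: L_def)
      ultimately show False by linarith
    qed (use wL v in blast)
  qed
  then have "{w. {v, w} \<in> E \<and> 2 \<le> degree E w} = {w. {v, w} \<in> E}" by blast
  then show ?thesis using v v2 degree_eq_card_neighbours[OF sg, of v] by auto
qed

text \<open>For \<open>\<Delta> = 2\<close> the root cannot be chosen arbitrarily: a root next to an end of the path has a leg with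
  a single vertex.\<close>
lemma suitable_root_exists:
  assumes tree: "is_tree V E" and md: "max_degree V E = \<Delta>" and "2 \<le> \<Delta>"
  obtains v where "v \<in> V" "degree E v = \<Delta>"
    "\<Delta> = 2 \<Longrightarrow> min 2 (card V - 3) \<le> card {w. {v, w} \<in> E \<and> 2 \<le> degree E w}"
    "\<Delta> = 2 \<Longrightarrow> \<forall>w\<in>V. degree E w \<le> 2"
proof -
  have sg: "simple_graph V E" and fin: "finite V" and ne: "V \<noteq> {}"
    using tree by (auto simp: is_tree_def simple_graph_def connected_graph_def)
  have le: "\<forall>w\<in>V. degree E w \<le> \<Delta>" using md fin by (auto simp: max_degree_def)
  have "\<Delta> \<in> degree E ` V"
    using md fin ne Max_in[of "degree E ` V"] by (simp add: max_degree_def)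
  then obtain v0 where v0: "v0 \<in> V" "degree E v0 = \<Delta>" by blast
  obtain par dep br where "rooted_tree V E v0 par dep br" using tree_rooted[OF tree v0(1)] by blast
  then interpret rooted_tree V E v0 par dep br .
  \<comment> \<open>For \<open>\<Delta> = 2\<close> the required number
    \<open>min 2 (card V - 3)\<close> of non-leaf neighbours is 2, 1 or 0 (truncated subtraction) in
    the three ranges of \<open>card V\<close>.\<close>
  consider "\<Delta> \<noteq> 2" | "\<Delta> = 2" "5 \<le> card V" | "\<Delta> = 2" "card V = 4" | "\<Delta> = 2" "card V \<le> 3" by linarith
  then show thesis
  proof cases
    case 1
    then show thesis using that v0 by blast
  next
    case 2
    then obtain v where "v \<in> V" "degree E v = 2" "2 \<le> card {w. {v, w} \<in> E \<and> 2 \<le> degree E w}"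
      using path_inner_vertex[OF sg] le v0 by auto
    then show thesis using 2 le by (intro that[of v]) auto
  next
    case 3
    then have "0 < card inner_children"
      using inner_children_nonempty v0 finite_subset[of inner_children V] fin
      by (auto simp: card_gt_0_iff inner_children_def children_def)
    then show thesis using that[OF v0] 3 le by (simp add: inner_children_eq)
  next
    case 4
    then show thesis using that[OF v0] le by simp
  qed
qed

section \<open>The best number of long legs and the two cases of the theorem\<close>

definition spider_weight :: "real \<Rightarrow> nat \<Rightarrow> nat \<Rightarrow> nat \<Rightarrow> real" where
  "spider_weight \<alpha> n \<Delta> p = (real n - 1 - real \<Delta>) * 4 powr \<alpha> + real \<Delta> * (real \<Delta> + 1) powr \<alpha>
     + real p * (3 powr \<alpha> - 4 powr \<alpha> - (real \<Delta> + 1) powr \<alpha> + (real \<Delta> + 2) powr \<alpha>)"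

text \<open>The coefficient of \<open>p\<close> is the drop of the power at 3 minus its drop at
  \<open>\<Delta> + 1\<close>: zero for \<open>\<Delta> = 2\<close> and positive for larger
  \<open>\<Delta>\<close>.\<close>

lemma spider_weight_mono:
  assumes "\<alpha> < 0" "2 \<le> \<Delta>" "p \<le> q"
  shows "spider_weight \<alpha> n \<Delta> p \<le> spider_weight \<alpha> n \<Delta> q"
    and "3 \<le> \<Delta> \<Longrightarrow> p < q \<Longrightarrow> spider_weight \<alpha> n \<Delta> p < spider_weight \<alpha> n \<Delta> q"
proof -
  define c where "c = 3 powr \<alpha> - 4 powr \<alpha> - (real \<Delta> + 1) powr \<alpha> + (real \<Delta> + 2) powr \<alpha>"
  have c: "0 < c" if "3 \<le> \<Delta>"
    using powr_diff_strict_antimono[of \<alpha> 3 "real \<Delta> + 1"] assms(1) that by (simp add: c_def add.commute)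
  have "c = 0" if "\<Delta> = 2" by (simp add: c_def that)
  then have "0 \<le> c" using c assms(2) by (cases "\<Delta> = 2") auto
  then show "spider_weight \<alpha> n \<Delta> p \<le> spider_weight \<alpha> n \<Delta> q"
    using assms(3) by (simp add: spider_weight_def mult_right_mono flip: c_def)
  show "spider_weight \<alpha> n \<Delta> p < spider_weight \<alpha> n \<Delta> q" if "3 \<le> \<Delta>" "p < q"
    using c that by (simp add: spider_weight_def flip: c_def)
qed

lemma (in rooted_tree) spider_chi_eq: "spider_chi \<alpha> = spider_weight \<alpha> (card V) (degree E r) (card inner_children)"
  by (simp add: spider_chi_def spider_weight_def)

lemma (in rooted_tree) card_inner_children_le_min:
  "card inner_children \<le> min (degree E r) (card V - 1 - degree E r)"
  using card_inner_children_le by linarith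

lemma chi_spider:
  assumes tree: "is_tree V E" and v: "v \<in> V" "degree E v = \<Delta>"
    and slim: "\<And>w. w \<in> V - {v} \<Longrightarrow> degree E w \<le> 2"
    and p: "min \<Delta> (card V - 1 - \<Delta>) \<le> card {w. {v, w} \<in> E \<and> 2 \<le> degree E w}"
  shows "chi \<alpha> E = spider_weight \<alpha> (card V) \<Delta> (min \<Delta> (card V - 1 - \<Delta>))"
proof -
  obtain par dep br where "rooted_tree V E v par dep br" using tree_rooted[OF tree v(1)] by blast
  then interpret rooted_tree V E v par dep br .
  have "card inner_children = min \<Delta> (card V - 1 - \<Delta>)"
    using p card_inner_children_le_min v by (simp only: inner_children_eq)
  then show ?thesis
    using chi_eq_spider_chi[OF slim] v by (simp add: spider_chi_eq)
qed

text \<open>Common core of both cases. In the case of equality a suitable rooting is returned, from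
  which \<open>iso_T_legs\<close> and \<open>iso_long_spider\<close> read off the shape of the
  tree.\<close>

lemma chi_le_spider_weight:
  assumes tree: "is_tree V E" and md: "max_degree V E = \<Delta>" "2 \<le> \<Delta>"
    and \<alpha>: "alpha1 \<le> \<alpha>" "\<alpha> < 0"
  defines "P \<equiv> min \<Delta> (card V - 1 - \<Delta>)"
  shows "chi \<alpha> E \<le> spider_weight \<alpha> (card V) \<Delta> P"
    and "chi \<alpha> E = spider_weight \<alpha> (card V) \<Delta> P \<Longrightarrow>
      \<exists>r par dep br. rooted_tree V E r par dep br \<and> degree E r = \<Delta> \<and>
        (\<forall>w\<in>V - {r}. degree E w \<le> 2) \<and> card (rooted_tree.inner_children V E r par) = P"
proof -
  obtain v where v: "v \<in> V" "degree E v = \<Delta>"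
    "\<Delta> = 2 \<Longrightarrow> min 2 (card V - 3) \<le> card {w. {v, w} \<in> E \<and> 2 \<le> degree E w}"
    "\<Delta> = 2 \<Longrightarrow> \<forall>w\<in>V. degree E w \<le> 2"
    using suitable_root_exists[OF tree md] by blast
  obtain par dep br where rt: "rooted_tree V E v par dep br" using tree_rooted[OF tree v(1)] by blast
  then interpret rooted_tree V E v par dep br .
  have p: "card inner_children \<le> P" using card_inner_children_le_min v by (simp add: P_def)
  have le: "chi \<alpha> E \<le> spider_weight \<alpha> (card V) \<Delta> (card inner_children)"
    using chi_le_spider_chi[OF \<alpha>] v by (simp add: spider_chi_eq)
  then show "chi \<alpha> E \<le> spider_weight \<alpha> (card V) \<Delta> P"
    using spider_weight_mono(1)[OF \<alpha>(2) md(2) p] by (rule order_trans)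
  assume eq: "chi \<alpha> E = spider_weight \<alpha> (card V) \<Delta> P"
  have slim: "degree E w \<le> 2" if w: "w \<in> V - {v}" for w
  proof (rule ccontr)
    assume "\<not> degree E w \<le> 2"
    then have "chi \<alpha> E < spider_weight \<alpha> (card V) \<Delta> (card inner_children)"
      using chi_less_spider_chi[OF \<alpha> w] v by (simp add: spider_chi_eq)
    then show False using eq spider_weight_mono(1)[OF \<alpha>(2) md(2) p, of "card V"] by linarith
  qed
  have "card inner_children = P"
  \<comment> \<open>For \<open>\<Delta> = 2\<close> the weight is constant in \<open>p\<close>, so
    the number of long legs comes from the choice of the root instead of from equality.\<close>
  proof (cases "\<Delta> = 2")
    case True
    then have "P \<le> card inner_children" using v(3) by (simp add: P_def inner_children_eq)
    then show ?thesis using p by simp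
  next
    case False
    then have "\<not> card inner_children < P"
      using spider_weight_mono(2)[OF \<alpha>(2) md(2) p, of "card V"] le eq md(2) by linarith
    then show ?thesis using p by simp
  qed
  then show "\<exists>r par dep br. rooted_tree V E r par dep br \<and> degree E r = \<Delta> \<and>
      (\<forall>w\<in>V - {r}. degree E w \<le> 2) \<and> card (rooted_tree.inner_children V E r par) = P"
    using rt slim v(2) by blast
qed

theorem theorem1:
  fixes V :: "'a set" and E :: "'a set set" and n \<Delta> :: nat and \<alpha> :: real
  assumes "3 \<le> n" and "2 \<le> \<Delta>" and "\<Delta> \<le> n - 1"
    and "alpha1 \<le> \<alpha>" and "\<alpha> < 0"
    and "is_tree V E" and "card V = n" and "max_degree V E = \<Delta>"
  shows "(real n / 2 \<le> real \<Delta> \<longrightarrow>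
            chi \<alpha> E \<le> ((real \<Delta> + 2) powr \<alpha> - (real \<Delta> + 1) powr \<alpha> + 3 powr \<alpha>)
                         * (real n - real \<Delta> - 1) + real \<Delta> * (real \<Delta> + 1) powr \<alpha>
          \<and> (chi \<alpha> E = ((real \<Delta> + 2) powr \<alpha> - (real \<Delta> + 1) powr \<alpha> + 3 powr \<alpha>)
                         * (real n - real \<Delta> - 1) + real \<Delta> * (real \<Delta> + 1) powr \<alpha>
             \<longleftrightarrow> graph_iso V E (spider_V (T_legs n \<Delta>)) (spider_E (T_legs n \<Delta>))))
       \<and> (real \<Delta> \<le> (real n - 1) / 2 \<longrightarrow>
            chi \<alpha> E \<le> ((real \<Delta> + 2) powr \<alpha> + 3 powr \<alpha> - 4 powr \<alpha>) * real \<Delta>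
                         + (real n - real \<Delta> - 1) * 4 powr \<alpha>
          \<and> (chi \<alpha> E = ((real \<Delta> + 2) powr \<alpha> + 3 powr \<alpha> - 4 powr \<alpha>) * real \<Delta>
                         + (real n - real \<Delta> - 1) * 4 powr \<alpha>
             \<longleftrightarrow> (\<exists>ls. length ls = \<Delta> \<and> (\<forall>l\<in>set ls. 2 \<le> l)
                      \<and> graph_iso V E (spider_V ls) (spider_E ls))))"
proof (intro conjI[of "_ \<longrightarrow> _"] impI)
  let ?P = "min \<Delta> (n - 1 - \<Delta>)"
  note le = chi_le_spider_weight[OF assms(6,8,2,4,5), unfolded assms(7)]
  note conv = chi_spider[OF assms(6), of _ \<Delta> \<alpha>, unfolded assms(7)]
  {
    assume "real n / 2 \<le> real \<Delta>"
    then have n: "n \<le> 2 * \<Delta>" by linarith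
    then have P: "?P = n - 1 - \<Delta>" by simp
    have B: "spider_weight \<alpha> n \<Delta> ?P = ((real \<Delta> + 2) powr \<alpha> - (real \<Delta> + 1) powr \<alpha> + 3 powr \<alpha>)
        * (real n - real \<Delta> - 1) + real \<Delta> * (real \<Delta> + 1) powr \<alpha>"
      unfolding P spider_weight_def using assms(1,3) by (simp add: of_nat_diff algebra_simps)
    have "graph_iso V E (spider_V (T_legs n \<Delta>)) (spider_E (T_legs n \<Delta>))"
      if eq: "chi \<alpha> E = spider_weight \<alpha> n \<Delta> ?P"
    proof -
      obtain r par dep br where rt: "rooted_tree V E r par dep br" "degree E r = \<Delta>"
        "\<forall>w\<in>V - {r}. degree E w \<le> 2" "card (rooted_tree.inner_children V E r par) = ?P"
        using le(2)[OF eq] by blast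
      show ?thesis
        using rooted_tree.iso_T_legs[OF rt(1)] rt P assms(1,3,7) by simp
    qed
    moreover have "chi \<alpha> E = spider_weight \<alpha> n \<Delta> ?P"
      if iso: "graph_iso V E (spider_V (T_legs n \<Delta>)) (spider_E (T_legs n \<Delta>))"
    proof -
      have pos: "\<forall>l\<in>set (T_legs n \<Delta>). 1 \<le> l" by (auto simp: T_legs_def)
      have len: "length (T_legs n \<Delta>) = \<Delta>" using n assms(1,3) by (simp add: T_legs_def)
      \<comment> \<open>The legs with two vertices occupy the last \<open>n - \<Delta> - 1\<close>
        of the \<open>\<Delta>\<close> positions.\<close>
      have "{j. j < length (T_legs n \<Delta>) \<and> 2 \<le> T_legs n \<Delta> ! j} = {2 * \<Delta> + 1 - n..<\<Delta>}"
        using n assms(1,3) by (auto simp: T_legs_def nth_append)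
      then have P_legs: "card {j. j < length (T_legs n \<Delta>) \<and> 2 \<le> T_legs n \<Delta> ! j} = ?P"
        using n assms(1,3) by simp
      show ?thesis
      proof (rule spider_iso_centre[OF assms(6) iso pos])
        fix v
        assume v: "v \<in> V" "degree E v = length (T_legs n \<Delta>)" "\<And>w. w \<in> V - {v} \<Longrightarrow> degree E w \<le> 2"
          and p: "card {j. j < length (T_legs n \<Delta>) \<and> 2 \<le> T_legs n \<Delta> ! j}
            \<le> card {w. {v, w} \<in> E \<and> 2 \<le> degree E w}"
        from v(2) len have "degree E v = \<Delta>" by (rule trans)
        from v(1) this v(3) p[unfolded P_legs] show ?thesis by (rule conv)
      qed
    qed
    ultimately show "chi \<alpha> E \<le> ((real \<Delta> + 2) powr \<alpha> - (real \<Delta> + 1) powr \<alpha> + 3 powr \<alpha>)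
                         * (real n - real \<Delta> - 1) + real \<Delta> * (real \<Delta> + 1) powr \<alpha>
          \<and> (chi \<alpha> E = ((real \<Delta> + 2) powr \<alpha> - (real \<Delta> + 1) powr \<alpha> + 3 powr \<alpha>)
                         * (real n - real \<Delta> - 1) + real \<Delta> * (real \<Delta> + 1) powr \<alpha>
             \<longleftrightarrow> graph_iso V E (spider_V (T_legs n \<Delta>)) (spider_E (T_legs n \<Delta>)))"
      using le(1) unfolding B by blast
  next
    assume "real \<Delta> \<le> (real n - 1) / 2"
    then have "real (2 * \<Delta> + 1) \<le> real n" by simp
    then have n: "2 * \<Delta> + 1 \<le> n" by (simp only: of_nat_le_iff)
    then have P: "?P = \<Delta>" by simp
    have B: "spider_weight \<alpha> n \<Delta> ?P = ((real \<Delta> + 2) powr \<alpha> + 3 powr \<alpha> - 4 powr \<alpha>) * real \<Delta>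
        + (real n - real \<Delta> - 1) * 4 powr \<alpha>"
      unfolding P spider_weight_def by (simp add: algebra_simps)
    have "\<exists>ls. length ls = \<Delta> \<and> (\<forall>l\<in>set ls. 2 \<le> l) \<and> graph_iso V E (spider_V ls) (spider_E ls)"
      if eq: "chi \<alpha> E = spider_weight \<alpha> n \<Delta> ?P"
    proof -
      obtain r par dep br where rt: "rooted_tree V E r par dep br" "degree E r = \<Delta>"
        "\<forall>w\<in>V - {r}. degree E w \<le> 2" "card (rooted_tree.inner_children V E r par) = ?P"
        using le(2)[OF eq] by blast
      show ?thesis
        using rooted_tree.iso_long_spider[OF rt(1)] rt P by simp
    qed
    moreover have "chi \<alpha> E = spider_weight \<alpha> n \<Delta> ?P"
      if ex: "\<exists>ls. length ls = \<Delta> \<and> (\<forall>l\<in>set ls. 2 \<le> l) \<and> graph_iso V E (spider_V ls) (spider_E ls)"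
    proof -
      obtain ls where ls: "length ls = \<Delta>" "\<forall>l\<in>set ls. 2 \<le> l"
        "graph_iso V E (spider_V ls) (spider_E ls)" using ex by blast
      then have pos: "\<forall>l\<in>set ls. 1 \<le> l" by fastforce
      have "{j. j < length ls \<and> 2 \<le> ls ! j} = {..<\<Delta>}" using ls by auto
      then have P_legs: "card {j. j < length ls \<and> 2 \<le> ls ! j} = ?P" using P by simp
      show ?thesis
      proof (rule spider_iso_centre[OF assms(6) ls(3) pos])
        fix v
        assume v: "v \<in> V" "degree E v = length ls" "\<And>w. w \<in> V - {v} \<Longrightarrow> degree E w \<le> 2"
          and p: "card {j. j < length ls \<and> 2 \<le> ls ! j} \<le> card {w. {v, w} \<in> E \<and> 2 \<le> degree E w}"
        from v(2) ls(1) have "degree E v = \<Delta>" by (rule trans)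
        from v(1) this v(3) p[unfolded P_legs] show ?thesis by (rule conv)
      qed
    qed
    ultimately show "chi \<alpha> E \<le> ((real \<Delta> + 2) powr \<alpha> + 3 powr \<alpha> - 4 powr \<alpha>) * real \<Delta>
                         + (real n - real \<Delta> - 1) * 4 powr \<alpha>
          \<and> (chi \<alpha> E = ((real \<Delta> + 2) powr \<alpha> + 3 powr \<alpha> - 4 powr \<alpha>) * real \<Delta>
                         + (real n - real \<Delta> - 1) * 4 powr \<alpha>
             \<longleftrightarrow> (\<exists>ls. length ls = \<Delta> \<and> (\<forall>l\<in>set ls. 2 \<le> l)
                      \<and> graph_iso V E (spider_V ls) (spider_E ls)))"
      using le(1) unfolding B by blast
  }
qed

end
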